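(* Let $d>4$ and $n$ be positive integers with $n>\frac{d(d+1)}{2}$, and let $\alpha_{n,d}=\sqrt{\frac{3n-d(d+2)}{(d+2)(n-d)}}$. The existence of the following are equivalent. (i) An antipodal spherical $4$-distance $5$-design in $\mathbb{S}^{d-1}$ of size $2n$ and of minimal type. (ii) Spherical $3$-designs $X_1,X_2,X_3$ in $\mathbb{S}^{d-2}$ with $X_1=-X_3$, $X_1\cap -X_1=\emptyset$, $X_2=-X_2$, $|X_1|=|X_3|=\frac{(d+2)n}{3d}$, $|X_2|=\frac{4(d-1)n}{3d}$, and $A(X_1),A(X_3)\subset\{-\frac{3}{d-1},\frac{(d+2)\alpha_{n,d}-3}{d-1},\frac{-(d+2)\alpha_{n,d}-3}{d-1}\}$, $A(X_2)\subset\{-1,0,\pm\alpha_{n,d}\}$, $A(X_1,X_2),A(X_2,X_3)\subset\{0,\pm\sqrt{\frac{d+2}{d-1}}\,\alpha_{n,d}\}$, and $A(X_1,X_3)\subset\{-1,\frac{3}{d-1},\frac{(d+2)\alpha_{n,d}+3}{d-1},\frac{-(d+2)\alpha_{n,d}+3}{d-1}\}$.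
   Context: Spherical $t$-design: a finite non-empty $Y\subset\mathbb{S}^{m-1}$ with $\int_{\mathbb{S}^{m-1}}f\,d\mu=\frac{1}{|Y|}\sum_{y\in Y}f(y)$ for all polynomials $f$ of degree $\le t$ ($\mu$ normalized surface measure). For finite $Y,Z$ on a sphere, $A(Y,Z)=\{\langle y,z\rangle\mid y\in Y,z\in Z,y\ne z\}$ and $A(Y)=A(Y,Y)$. A set $Y$ is an $s$-distance set if $|A(Y)|=s$, and antipodal if $Y=-Y$. A spherical $5$-design $D\subset\mathbb{S}^{d-1}$ is of minimal type if there is $\alpha\in\mathbb{R}^d$ with $\langle\alpha,x\rangle\in\{0,\pm1\}$ for all $x\in D$.
   Formalization: In the definition of minimal type the vector α is required to be nonzero; with α = 0 allowed every design would be of minimal type and the equivalence would fail (E8 roots, d = 8, n = 120). *)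

theory Defs
  imports "HOL-Analysis.Analysis"
begin

section \<open>Normalized surface measure on the unit sphere\<close>

text \<open>
  The normalized surface measure of a Borel set \<open>A\<close> of the unit sphere is the proportion of the
  volume of the unit ball that is occupied by the cone \<open>{r *\<^sub>R a | r a. 0 < r \<and> r < 1 \<and> a \<in> A}\<close>;
  that is, it is the image of the uniform distribution on the ball under \<open>x \<mapsto> x / norm x\<close>
  (for vectors this map is \<^const>\<open>sgn\<close>). It is represented as a measure on the Borel sets of the
  whole space that is concentrated on the sphere. The lemmas below show that it is a
  rotation-invariant probability measure on the sphere, which determines it uniquely.
\<close>

definition sphere_measure :: "'a::euclidean_space measure" where
  "sphere_measure = distr (uniform_measure lborel (ball 0 1)) borel sgn"

lemma sets_sphere_measure [simp, measurable_cong]: "sets sphere_measure = sets borel"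
  and space_sphere_measure [simp]: "space sphere_measure = UNIV"
  by (simp_all add: sphere_measure_def)

lemma borel_measurable_sgn_vector [measurable]:
  "sgn \<in> borel_measurable (borel :: 'a::euclidean_space measure)"
proof -
  have "(\<lambda>x::'a. x /\<^sub>R norm x) \<in> borel_measurable borel"
    by measurable
  then show ?thesis
    by (simp add: sgn_div_norm[abs_def])
qed

lemma lborel_unit_ball:
  shows "emeasure lborel (ball 0 1 :: 'a::euclidean_space set) \<noteq> 0"
    and "emeasure lborel (ball 0 1 :: 'a::euclidean_space set) < \<infinity>"
proof -
  show "emeasure lborel (ball 0 1 :: 'a set) < \<infinity>"
    by (rule emeasure_bounded_finite) simp
  have "measure lborel (ball 0 1 :: 'a set) > 0"
    using content_ball_pos[of 1 "0::'a"] by simp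
  then show "emeasure lborel (ball 0 1 :: 'a set) \<noteq> 0"
    by (auto simp: measure_def)
qed

lemma emeasure_sphere_measure_UNIV:
  "emeasure (sphere_measure :: 'a::euclidean_space measure) UNIV = 1"
  unfolding sphere_measure_def using lborel_unit_ball[where 'a='a]
  by (subst emeasure_distr) (auto simp: ennreal_divide_self)

lemma AE_sphere_measure: "AE x in sphere_measure. (x::'a::euclidean_space) \<in> sphere 0 1"
proof -
  have "AE x in lborel. x \<noteq> (0::'a)"
    by (rule AE_lborel_singleton)
  then have "AE x in uniform_measure lborel (ball 0 1). sgn x \<in> sphere (0::'a) 1"
    by (intro AE_uniform_measureI) (auto simp: norm_sgn elim!: eventually_mono)
  then show ?thesis
    unfolding sphere_measure_def by (subst AE_distr_iff) auto
qed

lemma lborel_distr_orthogonal: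
  fixes T :: "'a::euclidean_space \<Rightarrow> 'a"
  assumes T: "orthogonal_transformation T"
  shows "distr lborel borel T = lborel"
proof -
  define N where "N = distr lborel borel T"
  have lin: "linear T" and surjT: "surj T" and normT: "\<And>x. norm (T x) = norm x"
    using T by (auto simp: orthogonal_transformation_linear orthogonal_transformation_surj
        orthogonal_transformation_norm)
  have Tm [measurable]: "T \<in> borel_measurable borel"
    using lin by (intro borel_measurable_continuous_onI linear_continuous_on linear_conv_bounded_linear[THEN iffD1])
  have sN [simp, measurable_cong]: "sets N = sets borel"
    by (simp add: N_def)
  have shift_lborel: "(\<integral>\<^sup>+y. f (a + y) \<partial>lborel) = (\<integral>\<^sup>+y. f y \<partial>lborel)"
    if [measurable]: "f \<in> borel_measurable borel" for f :: "'a \<Rightarrow> ennreal" and a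
  proof -
    have "(\<integral>\<^sup>+y. f y \<partial>lborel) = (\<integral>\<^sup>+y. f y \<partial>distr lborel borel ((+) a))"
      by (simp add: lborel_distr_plus)
    then show ?thesis
      by (simp add: nn_integral_distr)
  qed
  have shift_N: "(\<integral>\<^sup>+y. f (a + y) \<partial>N) = (\<integral>\<^sup>+y. f y \<partial>N)"
    if [measurable]: "f \<in> borel_measurable borel" for f :: "'a \<Rightarrow> ennreal" and a
  proof -
    obtain b where a: "a = T b" using surjT by (metis surjD)
    have "(\<integral>\<^sup>+y. f (a + y) \<partial>N) = (\<integral>\<^sup>+y. f (T (b + y)) \<partial>lborel)"
      by (simp add: N_def nn_integral_distr a linear_add[OF lin])
    also have "\<dots> = (\<integral>\<^sup>+y. f (T y) \<partial>lborel)"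
      by (rule shift_lborel) measurable
    also have "\<dots> = (\<integral>\<^sup>+y. f y \<partial>N)"
      by (simp add: N_def nn_integral_distr)
    finally show ?thesis .
  qed
  have vim: "T -` ball 0 r = (ball 0 r :: 'a set)" for r
    by (auto simp: normT)
  have N_ball: "emeasure N (ball 0 r) = emeasure lborel (ball 0 r :: 'a set)" for r
    by (simp add: N_def emeasure_distr vim)
  interpret N: sigma_finite_measure N
  proof
    show "\<exists>A. countable A \<and> A \<subseteq> sets N \<and> \<Union>A = space N \<and> (\<forall>a\<in>A. emeasure N a \<noteq> \<infinity>)"
    proof (intro exI[of _ "range (\<lambda>n::nat. ball 0 (real n))"] conjI)
      show "\<Union>(range (\<lambda>n::nat. ball 0 (real n))) = space N"
        by (auto simp: N_def reals_Archimedean2)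
      show "\<forall>a\<in>range (\<lambda>n::nat. ball 0 (real n)). emeasure N a \<noteq> \<infinity>"
        using emeasure_bounded_finite[OF bounded_ball] by (auto simp: N_ball less_top)
    qed auto
  qed
  interpret P: pair_sigma_finite N lborel ..
  let ?B = "ball (0::'a) 1"
  have [measurable]: "?B \<in> sets borel"
    by simp
  have "N = lborel"
  proof (rule measure_eqI)
    fix A assume "A \<in> sets N"
    then have [measurable]: "A \<in> sets borel" by simp
    have flip: "(indicator ?B (- x + y) :: ennreal) = indicator ?B (- y + x)" for x y
      by (auto simp: indicator_def norm_minus_commute)
    have "emeasure N A * emeasure lborel ?B
        = (\<integral>\<^sup>+x. indicator A x * (\<integral>\<^sup>+y. indicator ?B y \<partial>lborel) \<partial>N)"
      by (simp add: nn_integral_multc)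
    also have "\<dots> = (\<integral>\<^sup>+x. indicator A x * (\<integral>\<^sup>+y. indicator ?B (- x + y) \<partial>lborel) \<partial>N)"
      by (subst shift_lborel) measurable
    also have "\<dots> = (\<integral>\<^sup>+x. \<integral>\<^sup>+y. indicator A x * indicator ?B (- x + y) \<partial>lborel \<partial>N)"
      by (simp add: nn_integral_cmult)
    also have "\<dots> = (\<integral>\<^sup>+y. \<integral>\<^sup>+x. indicator A x * indicator ?B (- x + y) \<partial>N \<partial>lborel)"
      by (rule P.Fubini'[symmetric]) measurable
    also have "\<dots> = (\<integral>\<^sup>+y. \<integral>\<^sup>+x. indicator A (y + x) * indicator ?B x \<partial>N \<partial>lborel)"
    proof (rule nn_integral_cong)
      fix y
      show "(\<integral>\<^sup>+x. indicator A x * indicator ?B (- x + y) \<partial>N)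
          = (\<integral>\<^sup>+x. indicator A (y + x) * indicator ?B x \<partial>N)"
        unfolding flip
        by (subst shift_N[of _ y, symmetric]) (auto simp: algebra_simps indicator_def)
    qed
    also have "\<dots> = (\<integral>\<^sup>+x. \<integral>\<^sup>+y. indicator A (y + x) * indicator ?B x \<partial>lborel \<partial>N)"
      by (rule P.Fubini') measurable
    also have "\<dots> = (\<integral>\<^sup>+x. (\<integral>\<^sup>+y. indicator A (x + y) \<partial>lborel) * indicator ?B x \<partial>N)"
      by (simp add: nn_integral_multc add.commute)
    also have "\<dots> = emeasure lborel A * emeasure N ?B"
      by (subst shift_lborel) (auto simp: nn_integral_cmult)
    finally have "emeasure N A * emeasure lborel ?B = emeasure lborel A * emeasure lborel ?B"
      by (simp add: N_ball)
    then show "emeasure N A = emeasure lborel A"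
      using lborel_unit_ball[where 'a='a]
      by (metis ennreal_mult_cancel_left infinity_ennreal_def less_irrefl mult.commute)
  qed simp
  then show ?thesis by (simp add: N_def)
qed

lemma sphere_measure_orthogonal:
  fixes T :: "'a::euclidean_space \<Rightarrow> 'a"
  assumes T: "orthogonal_transformation T"
  shows "distr sphere_measure borel T = sphere_measure"
proof -
  have lin: "linear T" and normT: "\<And>x. norm (T x) = norm x"
    using T by (auto simp: orthogonal_transformation_linear orthogonal_transformation_norm)
  have Tm [measurable]: "T \<in> borel_measurable borel"
    using lin by (intro borel_measurable_continuous_onI linear_continuous_on linear_conv_bounded_linear[THEN iffD1])
  have sgnT: "sgn (T x) = T (sgn x)" for x
    by (simp add: sgn_div_norm normT linear_scale[OF lin])
  have vim: "T -` ball 0 1 = ball 0 1"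
    by (auto simp: normT)
  show ?thesis
  proof (rule measure_eqI)
    fix A assume "A \<in> sets (distr sphere_measure borel T)"
    then have [measurable]: "A \<in> sets borel" by simp
    have s [measurable]: "sgn -` A \<in> sets borel"
      using measurable_sets[OF borel_measurable_sgn_vector, of A] by simp
    have t [measurable]: "T -` A \<in> sets borel"
      using measurable_sets[OF Tm, of A] by simp
    have st: "sgn -` T -` A \<in> sets borel"
      using measurable_sets[OF borel_measurable_sgn_vector t] by simp
    have "emeasure lborel (ball 0 1 \<inter> sgn -` A)
        = emeasure (distr lborel borel T) (ball 0 1 \<inter> sgn -` A)"
      by (simp add: lborel_distr_orthogonal[OF T])
    also have "\<dots> = emeasure lborel (T -` (ball 0 1 \<inter> sgn -` A))"
      by (subst emeasure_distr) auto
    also have "T -` (ball 0 1 \<inter> sgn -` A) = ball 0 1 \<inter> sgn -` T -` A"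
      unfolding vimage_Int vim by (auto simp: sgnT)
    finally show "emeasure (distr sphere_measure borel T) A = emeasure sphere_measure A"
      using s t st by (simp add: sphere_measure_def emeasure_distr)
  qed simp
qed

section \<open>Spherical designs\<close>

text \<open>
  Real polynomial functions of total degree at most \<open>t\<close> in the coordinates of \<open>real ^ 'm\<close>;
  the exponent vectors \<open>k\<close> range over a finite set.
\<close>

definition poly_fun_deg_le :: "nat \<Rightarrow> (real ^ 'm \<Rightarrow> real) \<Rightarrow> bool" where
  "poly_fun_deg_le t f \<longleftrightarrow>
     (\<exists>c :: ('m \<Rightarrow> nat) \<Rightarrow> real.
        f = (\<lambda>x. \<Sum>k\<in>{k. sum k UNIV \<le> t}. c k * (\<Prod>i\<in>UNIV. (x $ i) ^ k i)))"

lemma finite_exponents: "finite {k :: 'm::finite \<Rightarrow> nat. sum k UNIV \<le> t}"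
proof (rule finite_subset)
  show "{k :: 'm \<Rightarrow> nat. sum k UNIV \<le> t} \<subseteq> PiE UNIV (\<lambda>_. {..t})"
    by (auto simp: PiE_def) (meson UNIV_I finite member_le_sum order_trans zero_le)
qed (auto intro: finite_PiE)

lemma integrable_sphere_measure_poly_fun:
  assumes "poly_fun_deg_le t f"
  shows "integrable sphere_measure f"
proof -
  obtain c where f: "f = (\<lambda>x. \<Sum>k\<in>{k. sum k UNIV \<le> t}. c k * (\<Prod>i\<in>UNIV. (x $ i) ^ k i))"
    using assms by (auto simp: poly_fun_deg_le_def)
  have cont: "continuous_on UNIV f"
    unfolding f by (intro continuous_intros)
  then have "bounded (f ` sphere 0 1)"
    by (intro compact_imp_bounded compact_continuous_image) (auto intro: continuous_on_subset)
  then obtain b where b: "\<And>x. x \<in> sphere 0 1 \<Longrightarrow> norm (f x) \<le> b"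
    unfolding bounded_iff by blast
  interpret finite_measure "sphere_measure :: (real ^ 'a) measure"
    by (rule finite_measureI) (simp add: emeasure_sphere_measure_UNIV)
  show ?thesis
  proof (rule integrable_const_bound)
    show "AE x in sphere_measure. norm (f x) \<le> b"
      using AE_sphere_measure by eventually_elim (rule b)
    show "f \<in> borel_measurable sphere_measure"
      using borel_measurable_continuous_onI[OF cont]
      by (simp cong: measurable_cong_sets)
  qed
qed

definition spherical_design :: "nat \<Rightarrow> (real ^ 'm) set \<Rightarrow> bool" where
  "spherical_design t Y \<longleftrightarrow>
     finite Y \<and> Y \<noteq> {} \<and> Y \<subseteq> sphere 0 1 \<and>
     (\<forall>f. poly_fun_deg_le t f \<longrightarrow>
        (\<integral>x. f x \<partial>sphere_measure) = (\<Sum>y\<in>Y. f y) / real (card Y))"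

definition inner_products :: "'a::real_inner set \<Rightarrow> 'a set \<Rightarrow> real set" where
  "inner_products Y Z = {y \<bullet> z | y z. y \<in> Y \<and> z \<in> Z \<and> y \<noteq> z}"

definition distance_set :: "nat \<Rightarrow> 'a::real_inner set \<Rightarrow> bool" where
  "distance_set s Y \<longleftrightarrow> card (inner_products Y Y) = s"

definition antipodal :: "'a::real_vector set \<Rightarrow> bool" where
  "antipodal Y \<longleftrightarrow> Y = uminus ` Y"

text \<open>
  The vector \<open>a\<close> is required to be nonzero: with \<open>a = 0\<close> the condition would hold for every set.
\<close>

definition minimal_type :: "'a::real_inner set \<Rightarrow> bool" where
  "minimal_type D \<longleftrightarrow> (\<exists>a. a \<noteq> 0 \<and> (\<forall>x\<in>D. a \<bullet> x \<in> {0, 1, -1}))"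

definition alpha :: "nat \<Rightarrow> nat \<Rightarrow> real" where
  "alpha n d = sqrt ((3 * real n - real d * (real d + 2)) / ((real d + 2) * (real n - real d)))"

end

theory Submission
  imports Defs
begin

text \<open>
  By rotation invariance and polarization, an antipodal set is a 5-design iff its second and fourth
  moments in every direction agree with those of the sphere. The moments along a vector \<open>a\<close> with
  \<open>\<langle>a, x\<rangle> \<in> {0, \<plusminus>1}\<close> force \<open>|a|\<^sup>2 = (d + 2) / 3\<close>, so \<open>D\<close> is the union of three parallel slices at heights
  \<open>0, \<plusminus>h\<close> with \<open>h\<^sup>2 = 3 / (d + 2)\<close>, and the moments at a point of \<open>D\<close> force the inner products
  \<open>\<plusminus>\<alpha>\<close>. Conversely, gluing the slices gives a set with the right second moments; these
  determine how often \<open>\<plusminus>\<alpha>\<close> occurs at each point, hence \<open>\<Sum>\<^sub>x\<^sub>,\<^sub>y \<langle>x, y\<rangle>\<^sup>4\<close>, and this sum attains its lower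
  bound only if the fourth moment tensor is isotropic.
\<close>

section \<open>Designs and moments\<close>

lemma poly_fun_deg_le_monomial:
  fixes k :: "'m::finite \<Rightarrow> nat"
  assumes "sum k UNIV \<le> t"
  shows "poly_fun_deg_le t (\<lambda>x. \<Prod>i\<in>UNIV. (x $ i) ^ k i)"
  unfolding poly_fun_deg_le_def
proof (intro exI ext)
  fix x :: "real ^ 'm"
  have "(\<Sum>j\<in>{j. sum j UNIV \<le> t}. (if j = k then 1 else 0) * (\<Prod>i\<in>UNIV. (x $ i) ^ j i))
      = (\<Sum>j\<in>{j. sum j UNIV \<le> t}. if j = k then (\<Prod>i\<in>UNIV. (x $ i) ^ j i) else 0)"
    by (intro sum.cong) auto
  also have "\<dots> = (\<Prod>i\<in>UNIV. (x $ i) ^ k i)"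
    using assms by (simp add: finite_exponents)
  finally show "(\<Prod>i\<in>UNIV. (x $ i) ^ k i)
      = (\<Sum>j\<in>{j. sum j UNIV \<le> t}. (if j = k then 1 else 0) * (\<Prod>i\<in>UNIV. (x $ i) ^ j i))" ..
qed

lemma poly_fun_deg_le_zero: "poly_fun_deg_le t (\<lambda>_. 0)"
  unfolding poly_fun_deg_le_def by (rule exI[of _ "\<lambda>_. 0"]) simp

lemma poly_fun_deg_le_add:
  assumes "poly_fun_deg_le t f" "poly_fun_deg_le t g"
  shows "poly_fun_deg_le t (\<lambda>x. f x + g x)"
proof -
  from assms obtain a b where
    "f = (\<lambda>x. \<Sum>k\<in>{k. sum k UNIV \<le> t}. a k * (\<Prod>i\<in>UNIV. (x $ i) ^ k i))"
    "g = (\<lambda>x. \<Sum>k\<in>{k. sum k UNIV \<le> t}. b k * (\<Prod>i\<in>UNIV. (x $ i) ^ k i))"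
    by (auto simp: poly_fun_deg_le_def)
  then show ?thesis
    unfolding poly_fun_deg_le_def
    by (intro exI[of _ "\<lambda>k. a k + b k"]) (simp add: sum.distrib distrib_right)
qed

lemma poly_fun_deg_le_cmult:
  assumes "poly_fun_deg_le t f"
  shows "poly_fun_deg_le t (\<lambda>x. c * f x)"
proof -
  from assms obtain a where
    "f = (\<lambda>x. \<Sum>k\<in>{k. sum k UNIV \<le> t}. a k * (\<Prod>i\<in>UNIV. (x $ i) ^ k i))"
    by (auto simp: poly_fun_deg_le_def)
  then show ?thesis
    unfolding poly_fun_deg_le_def
    by (intro exI[of _ "\<lambda>k. c * a k"]) (simp add: sum_distrib_left mult.assoc)
qed

lemma poly_fun_deg_le_sum:
  assumes "\<And>i. i \<in> I \<Longrightarrow> poly_fun_deg_le t (f i)"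
  shows "poly_fun_deg_le t (\<lambda>x. \<Sum>i\<in>I. f i x)"
  using assms
  by (induction I rule: infinite_finite_induct)
    (auto intro: poly_fun_deg_le_zero poly_fun_deg_le_add)

lemma poly_fun_deg_le_component_mult:
  fixes f :: "real ^ 'm \<Rightarrow> real"
  assumes "poly_fun_deg_le t f"
  shows "poly_fun_deg_le (Suc t) (\<lambda>x. x $ j * f x)"
proof -
  from assms obtain a where f:
    "f = (\<lambda>x. \<Sum>k\<in>{k. sum k UNIV \<le> t}. a k * (\<Prod>i\<in>UNIV. (x $ i) ^ k i))"
    by (auto simp: poly_fun_deg_le_def)
  have mono: "x $ j * (\<Prod>i\<in>UNIV. (x $ i) ^ k i) = (\<Prod>i\<in>UNIV. (x $ i) ^ (k(j := Suc (k j))) i)"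
    for x :: "real ^ 'm" and k :: "'m \<Rightarrow> nat"
  proof -
    have "(\<Prod>i\<in>UNIV. (x $ i) ^ (k(j := Suc (k j))) i)
        = (x $ j) ^ Suc (k j) * (\<Prod>i\<in>UNIV - {j}. (x $ i) ^ (k(j := Suc (k j))) i)"
      by (subst prod.remove[of _ j]) auto
    also have "(\<Prod>i\<in>UNIV - {j}. (x $ i) ^ (k(j := Suc (k j))) i) = (\<Prod>i\<in>UNIV - {j}. (x $ i) ^ k i)"
      by (intro prod.cong) auto
    finally show ?thesis
      by (subst prod.remove[of _ j]) auto
  qed
  have deg: "sum (k(j := Suc (k j))) UNIV = Suc (sum k UNIV)" for k :: "'m \<Rightarrow> nat"
    by (subst (1 2) sum.remove[of _ j]) auto
  have "(\<lambda>x. x $ j * f x) = (\<lambda>x. \<Sum>k\<in>{k. sum k UNIV \<le> t}.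
      a k * (\<Prod>i\<in>UNIV. (x $ i) ^ (k(j := Suc (k j))) i))"
    unfolding f mono[symmetric] by (simp add: sum_distrib_left mult.left_commute)
  moreover have "poly_fun_deg_le (Suc t) (\<lambda>x. \<Sum>k\<in>{k. sum k UNIV \<le> t}.
      a k * (\<Prod>i\<in>UNIV. (x $ i) ^ (k(j := Suc (k j))) i))"
    by (intro poly_fun_deg_le_sum poly_fun_deg_le_cmult poly_fun_deg_le_monomial)
      (simp add: deg del: fun_upd_apply)
  ultimately show ?thesis
    by simp
qed

lemma poly_fun_deg_le_inner_mult:
  fixes f :: "real ^ 'm \<Rightarrow> real"
  assumes "poly_fun_deg_le t f"
  shows "poly_fun_deg_le (Suc t) (\<lambda>x. (v \<bullet> x) * f x)"
proof -
  have "poly_fun_deg_le (Suc t) (\<lambda>x. \<Sum>j\<in>UNIV. v $ j * (x $ j * f x))"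
    by (intro poly_fun_deg_le_sum poly_fun_deg_le_cmult poly_fun_deg_le_component_mult assms)
  then show ?thesis
    by (simp add: inner_vec_def sum_distrib_right mult.assoc)
qed

lemma poly_fun_deg_le_inner_power:
  fixes v :: "real ^ 'm"
  assumes "k \<le> t"
  shows "poly_fun_deg_le t (\<lambda>x. (v \<bullet> x) ^ k)"
  using assms
proof (induction k arbitrary: t)
  case 0
  show ?case
    using poly_fun_deg_le_monomial[of "\<lambda>_::'m. 0" t] by simp
next
  case (Suc k)
  then obtain t' where "t = Suc t'" "k \<le> t'"
    by (cases t) auto
  with Suc.IH[of t'] show ?case
    using poly_fun_deg_le_inner_mult[of t' "\<lambda>x. (v \<bullet> x) ^ k" v] by simp
qed

lemma integrable_sphere_measure_continuous:
  fixes f :: "'a::euclidean_space \<Rightarrow> real"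
  assumes cont: "continuous_on UNIV f"
  shows "integrable sphere_measure f"
proof -
  have "bounded (f ` sphere 0 1)"
    using cont by (intro compact_imp_bounded compact_continuous_image) (auto intro: continuous_on_subset)
  then obtain b where b: "\<And>x. x \<in> sphere 0 1 \<Longrightarrow> norm (f x) \<le> b"
    unfolding bounded_iff by blast
  interpret finite_measure "sphere_measure :: 'a measure"
    by (rule finite_measureI) (simp add: emeasure_sphere_measure_UNIV)
  show ?thesis
  proof (rule integrable_const_bound)
    show "AE x in sphere_measure. norm (f x) \<le> b"
      using AE_sphere_measure by eventually_elim (rule b)
    show "f \<in> borel_measurable sphere_measure"
      using borel_measurable_continuous_onI[OF cont] by (simp cong: measurable_cong_sets)
  qed
qed

text \<open>
  Polarization: the coefficient of \<open>s\<close> in \<open>((v + s u) \<bullet> x) ^ Suc a\<close> trades one factor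
  \<open>v \<bullet> x\<close> for a factor \<open>u \<bullet> x\<close>.
\<close>

lemma sphere_average_inner_power_prod_list:
  fixes Y :: "(real ^ 'm) set"
  assumes mom: "\<And>v k. k \<le> t \<Longrightarrow>
      (\<integral>x. (v \<bullet> x) ^ k \<partial>sphere_measure) = (\<Sum>y\<in>Y. (v \<bullet> y) ^ k) / real (card Y)"
    and "a + length us \<le> t"
  shows "(\<integral>x. (v \<bullet> x) ^ a * (\<Prod>u\<leftarrow>us. u \<bullet> x) \<partial>sphere_measure)
      = (\<Sum>y\<in>Y. (v \<bullet> y) ^ a * (\<Prod>u\<leftarrow>us. u \<bullet> y)) / real (card Y)"
  using assms(2)
proof (induction us arbitrary: a v)
  case Nil
  then show ?case using mom by simp
next
  case (Cons u us)
  define P where "P = (\<lambda>x. \<Prod>u\<leftarrow>us. u \<bullet> (x :: real ^ 'm))"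
  define I where "I = (\<lambda>f::real ^ 'm \<Rightarrow> real. (\<integral>x. f x \<partial>sphere_measure) - (\<Sum>y\<in>Y. f y) / real (card Y))"
  have contP: "continuous_on UNIV P"
    unfolding P_def
    by (induction us) (auto intro!: continuous_intros)
  define c where "c = (\<lambda>i. real (Suc a choose i) * I (\<lambda>x. (u \<bullet> x) ^ i * (v \<bullet> x) ^ (Suc a - i) * P x))"
  have "(\<Sum>i\<le>Suc a. c i * s ^ i) = 0" for s
  proof -
    have exp: "((v + s *\<^sub>R u) \<bullet> x) ^ Suc a * P x
        = (\<Sum>i\<le>Suc a. real (Suc a choose i) * s ^ i * ((u \<bullet> x) ^ i * (v \<bullet> x) ^ (Suc a - i) * P x))" for x
    proof -
      have "((v + s *\<^sub>R u) \<bullet> x) ^ Suc a = (s * (u \<bullet> x) + v \<bullet> x) ^ Suc a"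
        by (simp add: inner_add_left add.commute)
      also have "\<dots> = (\<Sum>i\<le>Suc a. real (Suc a choose i) * (s * (u \<bullet> x)) ^ i * (v \<bullet> x) ^ (Suc a - i))"
        by (rule binomial_ring)
      finally show ?thesis
        by (simp only: sum_distrib_right power_mult_distrib mult.assoc)
    qed
    have "0 = I (\<lambda>x. ((v + s *\<^sub>R u) \<bullet> x) ^ Suc a * P x)"
      unfolding I_def P_def using Cons.IH[of "Suc a" "v + s *\<^sub>R u"] Cons.prems by simp
    also have "\<dots> = (\<Sum>i\<le>Suc a. c i * s ^ i)"
    proof -
      define Q where "Q = (\<lambda>i x. (u \<bullet> x) ^ i * (v \<bullet> x) ^ (Suc a - i) * P x)"
      define J K where "J = (\<lambda>i. \<integral>x. Q i x \<partial>sphere_measure)" and "K = (\<lambda>i. \<Sum>y\<in>Y. Q i y)"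
      have "(\<integral>x. ((v + s *\<^sub>R u) \<bullet> x) ^ Suc a * P x \<partial>sphere_measure)
          = (\<Sum>i\<le>Suc a. real (Suc a choose i) * s ^ i * J i)"
        unfolding exp Q_def J_def
        by (subst Bochner_Integration.integral_sum)
          (auto intro!: integrable_sphere_measure_continuous continuous_intros contP
            simp del: sum.atMost_Suc)
      moreover have "(\<Sum>y\<in>Y. ((v + s *\<^sub>R u) \<bullet> y) ^ Suc a * P y)
          = (\<Sum>i\<le>Suc a. real (Suc a choose i) * s ^ i * K i)"
        unfolding exp Q_def K_def by (subst sum.swap) (simp only: sum_distrib_left)
      moreover have "c i = real (Suc a choose i) * (J i - K i / real (card Y))" for i
        unfolding c_def I_def Q_def J_def K_def ..
      ultimately show ?thesis
        unfolding I_def by (simp only: sum_divide_distrib sum_subtractf[symmetric])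
          (intro sum.cong refl, simp add: algebra_simps)
    qed
    finally show ?thesis ..
  qed
  then have "c 1 = 0"
    using polyfun_eq_0[of c "Suc a"] by (metis One_nat_def Suc_le_mono le0)
  then have "I (\<lambda>x. (u \<bullet> x) * (v \<bullet> x) ^ a * P x) = 0"
    unfolding c_def by simp
  then show ?case
    unfolding I_def P_def by (simp add: ac_simps)
qed

lemma spherical_design_iff_moments:
  fixes Y :: "(real ^ 'm) set"
  shows "spherical_design t Y \<longleftrightarrow> finite Y \<and> Y \<noteq> {} \<and> Y \<subseteq> sphere 0 1 \<and>
    (\<forall>k\<le>t. \<forall>v. (\<integral>x. (v \<bullet> x) ^ k \<partial>sphere_measure) = (\<Sum>y\<in>Y. (v \<bullet> y) ^ k) / real (card Y))"
proof (intro iffI conjI allI impI)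
  assume D: "spherical_design t Y"
  then show "finite Y" "Y \<noteq> {}" "Y \<subseteq> sphere 0 1"
    by (auto simp: spherical_design_def)
  fix k v assume "k \<le> t"
  then show "(\<integral>x. (v \<bullet> x) ^ k \<partial>sphere_measure) = (\<Sum>y\<in>Y. (v \<bullet> y) ^ k) / real (card Y)"
    using D poly_fun_deg_le_inner_power[of k t v] by (auto simp: spherical_design_def)
next
  assume R: "finite Y \<and> Y \<noteq> {} \<and> Y \<subseteq> sphere 0 1 \<and>
    (\<forall>k\<le>t. \<forall>v. (\<integral>x. (v \<bullet> x) ^ k \<partial>sphere_measure) = (\<Sum>y\<in>Y. (v \<bullet> y) ^ k) / real (card Y))"
  have mono: "(\<integral>x. (\<Prod>i\<in>UNIV. (x $ i) ^ k i) \<partial>sphere_measure)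
      = (\<Sum>y\<in>Y. (\<Prod>i\<in>UNIV. (y $ i) ^ k i)) / real (card Y)"
    if k: "sum k UNIV \<le> t" for k :: "'m \<Rightarrow> nat"
  proof -
    obtain ixs :: "'m list" where ixs: "set ixs = UNIV" "distinct ixs"
      using finite_distinct_list[of "UNIV :: 'm set"] by auto
    define us :: "(real ^ 'm) list" where "us = concat (map (\<lambda>i. replicate (k i) (axis i 1)) ixs)"
    have "length us = sum_list (map k ixs)"
      by (simp add: us_def length_concat comp_def)
    also have "\<dots> = sum k UNIV"
      using ixs by (simp add: sum_list_distinct_conv_sum_set)
    finally have len: "0 + length us \<le> t"
      using k by simp
    have "(\<Prod>u\<leftarrow>us. u \<bullet> x) = (\<Prod>i\<leftarrow>ixs. (x $ i) ^ k i)" for x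
      unfolding us_def
      by (induction ixs) (simp_all add: prod_list_replicate inner_axis')
    also have "(\<Prod>i\<leftarrow>ixs. (x $ i) ^ k i) = (\<Prod>i\<in>UNIV. (x $ i) ^ k i)" for x :: "real ^ 'm"
      using ixs by (simp add: prod.distinct_set_conv_list[symmetric])
    finally show ?thesis
      using sphere_average_inner_power_prod_list[of t Y 0 us 0] R len by simp
  qed
  show "spherical_design t Y"
    unfolding spherical_design_def
  proof (intro conjI allI impI)
    fix f :: "real ^ 'm \<Rightarrow> real"
    assume "poly_fun_deg_le t f"
    then obtain c where f: "f = (\<lambda>x. \<Sum>k\<in>{k. sum k UNIV \<le> t}. c k * (\<Prod>i\<in>UNIV. (x $ i) ^ k i))"
      by (auto simp: poly_fun_deg_le_def)
    have "(\<integral>x. f x \<partial>sphere_measure) = (\<Sum>k\<in>{k. sum k UNIV \<le> t}.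
        c k * (\<integral>x. (\<Prod>i\<in>UNIV. (x $ i) ^ k i) \<partial>sphere_measure))"
      unfolding f
      by (subst Bochner_Integration.integral_sum)
        (auto intro!: integrable_sphere_measure_continuous continuous_intros)
    also have "\<dots> = (\<Sum>k\<in>{k. sum k UNIV \<le> t}.
        c k * ((\<Sum>y\<in>Y. (\<Prod>i\<in>UNIV. (y $ i) ^ k i)) / real (card Y)))"
      by (intro sum.cong refl) (simp add: mono)
    also have "\<dots> = (\<Sum>y\<in>Y. f y) / real (card Y)"
      unfolding f by (subst sum.swap) (simp add: sum_distrib_left sum_divide_distrib)
    finally show "(\<integral>x. f x \<partial>sphere_measure) = (\<Sum>y\<in>Y. f y) / real (card Y)" .
  qed (use R in auto)
qed

lemma integral_sphere_measure_orthogonal: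
  fixes T :: "'a::euclidean_space \<Rightarrow> 'a" and f :: "'a \<Rightarrow> real"
  assumes T: "orthogonal_transformation T" and f: "continuous_on UNIV f"
  shows "(\<integral>x. f (T x) \<partial>sphere_measure) = (\<integral>x. f x \<partial>sphere_measure)"
proof -
  have [measurable]: "T \<in> borel_measurable borel"
    using T by (intro borel_measurable_continuous_onI linear_continuous_on)
      (simp add: orthogonal_transformation_def linear_conv_bounded_linear)
  have [measurable]: "f \<in> borel_measurable borel"
    using f by (rule borel_measurable_continuous_onI)
  have "(\<integral>x. f x \<partial>sphere_measure) = (\<integral>x. f x \<partial>distr sphere_measure borel T)"
    by (simp add: sphere_measure_orthogonal[OF T])
  also have "\<dots> = (\<integral>x. f (T x) \<partial>sphere_measure)"
    by (subst integral_distr) auto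
  finally show ?thesis ..
qed

lemma sphere_moment_odd:
  fixes v :: "'a::euclidean_space"
  assumes "odd k"
  shows "(\<integral>x. (v \<bullet> x) ^ k \<partial>sphere_measure) = 0"
proof -
  have "orthogonal_transformation (uminus :: 'a \<Rightarrow> 'a)"
    by (auto simp: orthogonal_transformation_def intro!: linearI)
  moreover have "continuous_on UNIV (\<lambda>x. (v \<bullet> x) ^ k)"
    by (intro continuous_intros)
  ultimately show ?thesis
    using integral_sphere_measure_orthogonal[of uminus "\<lambda>x. (v \<bullet> x) ^ k"] assms by simp
qed

lemma sphere_moment_homogeneous:
  fixes v b :: "real ^ 'm"
  assumes "norm b = 1"
  shows "(\<integral>x. (v \<bullet> x) ^ k \<partial>sphere_measure) = norm v ^ k * (\<integral>x. (b \<bullet> x) ^ k \<partial>sphere_measure)"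
proof -
  have "norm (norm v *\<^sub>R b) = norm v" using assms by simp
  from orthogonal_transformation_exists[OF this]
  obtain T where T: "orthogonal_transformation T" "T (norm v *\<^sub>R b) = v"
    by auto
  have "(\<integral>x. (v \<bullet> x) ^ k \<partial>sphere_measure) = (\<integral>x. (v \<bullet> T x) ^ k \<partial>sphere_measure)"
    by (rule integral_sphere_measure_orthogonal[OF T(1), symmetric]) (intro continuous_intros)
  also have "\<dots> = (\<integral>x. (norm v *\<^sub>R b \<bullet> x) ^ k \<partial>sphere_measure)"
    using T by (metis orthogonal_transformation_def)
  finally show ?thesis
    by (simp add: power_mult_distrib)
qed

lemma integral_sphere_measure_const: "(integral\<^sup>L sphere_measure (\<lambda>x::'a::euclidean_space. c)) = (c :: real)"
  by (simp add: measure_def emeasure_sphere_measure_UNIV)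

lemma integral_sphere_measure_norm_power:
  "(integral\<^sup>L sphere_measure (\<lambda>x::'a::euclidean_space. norm x ^ k)) = 1"
proof -
  have "(integral\<^sup>L sphere_measure (\<lambda>x::'a. norm x ^ k)) = (integral\<^sup>L sphere_measure (\<lambda>x::'a. 1))"
  proof (rule integral_cong_AE)
    show "AE x::'a in sphere_measure. norm x ^ k = 1"
      using AE_sphere_measure by eventually_elim simp
  qed auto
  then show ?thesis by (simp only: integral_sphere_measure_const)
qed

lemma sphere_moment_2:
  fixes v :: "real ^ 'm"
  shows "(\<integral>x. (v \<bullet> x)\<^sup>2 \<partial>sphere_measure) = (norm v)\<^sup>2 / CARD('m)"
proof -
  obtain b :: "real ^ 'm" where b: "b \<in> Basis" by fastforce
  define M where "M = (\<integral>x. (b \<bullet> x)\<^sup>2 \<partial>sphere_measure)"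
  have M: "(\<integral>x. (c \<bullet> x)\<^sup>2 \<partial>sphere_measure) = (norm c)\<^sup>2 * M" for c :: "real ^ 'm"
    unfolding M_def using b by (intro sphere_moment_homogeneous) simp
  have "1 = (integral\<^sup>L sphere_measure (\<lambda>x::real ^ 'm. (norm x)\<^sup>2))"
    by (simp add: integral_sphere_measure_norm_power)
  also have "\<dots> = (integral\<^sup>L sphere_measure (\<lambda>x::real ^ 'm. (\<Sum>b\<in>Basis. (b \<bullet> x)\<^sup>2)))"
  proof (intro Bochner_Integration.integral_cong refl)
    fix x :: "real ^ 'm"
    show "(norm x)\<^sup>2 = (\<Sum>b\<in>Basis. (b \<bullet> x)\<^sup>2)"
      unfolding power2_norm_eq_inner
      by (simp add: euclidean_inner[of x x] power2_eq_square inner_commute)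
  qed
  also have "\<dots> = (\<Sum>b\<in>(Basis::(real ^ 'm) set). (\<integral>x. (b \<bullet> x)\<^sup>2 \<partial>sphere_measure))"
    by (rule Bochner_Integration.integral_sum)
      (intro integrable_sphere_measure_continuous continuous_intros)
  also have "\<dots> = CARD('m) * M"
    by (simp add: M)
  finally show ?thesis
    by (simp add: M field_simps)
qed

lemma sphere_moment_4:
  fixes v :: "real ^ 'm"
  shows "(\<integral>x. (v \<bullet> x) ^ 4 \<partial>sphere_measure) = 3 * norm v ^ 4 / (CARD('m) * (CARD('m) + 2))"
proof -
  obtain b :: "real ^ 'm" where b: "b \<in> Basis" by fastforce
  define M where "M = (\<integral>x. (b \<bullet> x) ^ 4 \<partial>sphere_measure)"
  have M: "(\<integral>x. (c \<bullet> x) ^ 4 \<partial>sphere_measure) = norm c ^ 4 * M" for c :: "real ^ 'm"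
    unfolding M_def using b by (intro sphere_moment_homogeneous) simp
  have int: "integrable sphere_measure (\<lambda>x. (c \<bullet> x) ^ k)"
    "integrable sphere_measure (\<lambda>x. (c \<bullet> x) ^ k * (c' \<bullet> x) ^ l)" for c c' :: "real ^ 'm" and k l
    by (intro integrable_sphere_measure_continuous continuous_intros)+
  have mixed: "(\<integral>x. (c \<bullet> x)\<^sup>2 * (c' \<bullet> x)\<^sup>2 \<partial>sphere_measure) = (if c = c' then M else M / 3)"
    if c: "c \<in> Basis" "c' \<in> Basis" for c c' :: "real ^ 'm"
  proof (cases "c = c'")
    case True
    have "(c' \<bullet> x)\<^sup>2 * (c' \<bullet> x)\<^sup>2 = (c' \<bullet> x) ^ 4" for x
      by (simp flip: power_add)
    with True c M[of c] show ?thesis by simp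
  next
    case False
    have "(norm (c + c'))\<^sup>2 = 2" "(norm (c - c'))\<^sup>2 = 2"
      using c False by (simp_all add: power2_norm_eq_inner inner_simps inner_Basis)
    then have n: "norm (c + c') ^ 4 = 4" "norm (c - c') ^ 4 = 4"
      using power_mult[of "norm (c + c')" 2 2] power_mult[of "norm (c - c')" 2 2] by simp_all
    have "8 * M = (\<integral>x. ((c + c') \<bullet> x) ^ 4 \<partial>sphere_measure) + (\<integral>x. ((c - c') \<bullet> x) ^ 4 \<partial>sphere_measure)"
      unfolding M n by simp
    also have "\<dots> = (\<integral>x. ((c + c') \<bullet> x) ^ 4 + ((c - c') \<bullet> x) ^ 4 \<partial>sphere_measure)"
      by (simp add: int)
    also have "\<dots> = (\<integral>x. 2 * (c \<bullet> x) ^ 4 + 12 * ((c \<bullet> x)\<^sup>2 * (c' \<bullet> x)\<^sup>2) + 2 * (c' \<bullet> x) ^ 4 \<partial>sphere_measure)"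
      by (intro Bochner_Integration.integral_cong refl)
        (simp add: inner_simps, algebra)
    also have "\<dots> = 4 * M + 12 * (\<integral>x. (c \<bullet> x)\<^sup>2 * (c' \<bullet> x)\<^sup>2 \<partial>sphere_measure)"
      using c by (simp add: int M)
    finally show ?thesis using False by simp
  qed
  have "1 = (integral\<^sup>L sphere_measure (\<lambda>x::real ^ 'm. norm x ^ 4))"
    by (simp add: integral_sphere_measure_norm_power)
  also have "\<dots> = (integral\<^sup>L sphere_measure (\<lambda>x::real ^ 'm. (\<Sum>b\<in>Basis. \<Sum>c\<in>Basis. (b \<bullet> x)\<^sup>2 * (c \<bullet> x)\<^sup>2)))"
  proof (intro Bochner_Integration.integral_cong refl)
    fix x :: "real ^ 'm"
    have "norm x ^ 4 = (x \<bullet> x) * (x \<bullet> x)"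
      using power_add[of "norm x" 2 2] by (simp add: power2_norm_eq_inner)
    also have "x \<bullet> x = (\<Sum>b\<in>Basis. (b \<bullet> x)\<^sup>2)"
      by (simp add: euclidean_inner[of x x] power2_eq_square inner_commute)
    finally show "norm x ^ 4 = (\<Sum>b\<in>Basis. \<Sum>c\<in>Basis. (b \<bullet> x)\<^sup>2 * (c \<bullet> x)\<^sup>2)"
      by (simp add: sum_product)
  qed
  also have "\<dots> = (\<Sum>b\<in>(Basis::(real ^ 'm) set). \<Sum>c\<in>Basis. (\<integral>x. (b \<bullet> x)\<^sup>2 * (c \<bullet> x)\<^sup>2 \<partial>sphere_measure))"
    by (subst Bochner_Integration.integral_sum Bochner_Integration.integral_sum,
        (intro integrable_sphere_measure_continuous continuous_intros)[1])+
      (intro sum.cong refl Bochner_Integration.integral_sum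
        integrable_sphere_measure_continuous continuous_intros)
  also have "\<dots> = (\<Sum>b\<in>(Basis::(real ^ 'm) set). \<Sum>c\<in>Basis. M / 3 + (if b = c then 2 * M / 3 else 0))"
    by (intro sum.cong refl) (simp add: mixed)
  also have "\<dots> = (\<Sum>b\<in>(Basis::(real ^ 'm) set). CARD('m) * (M / 3) + 2 * M / 3)"
    by (intro sum.cong refl) (simp add: sum.distrib)
  also have "\<dots> = CARD('m) * (CARD('m) + 2) * M / 3"
    by (simp add: field_simps)
  finally have "M * (CARD('m) * (CARD('m) + 2)) = 3"
    by (simp add: mult.commute)
  moreover have "real (CARD('m) * (CARD('m) + 2)) \<noteq> 0"
    unfolding of_nat_eq_0_iff by simp
  ultimately have "M = 3 / (CARD('m) * (CARD('m) + 2))"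
    by (metis eq_divide_eq)
  then show ?thesis
    by (simp add: M)
qed

lemma sum_antipodal_odd:
  fixes g :: "'a::real_vector \<Rightarrow> real"
  assumes "antipodal Y" and odd: "\<And>y. g (- y) = - g y"
  shows "sum g Y = 0"
proof -
  have "sum g Y = sum g (uminus ` Y)"
    using assms by (simp add: antipodal_def)
  also have "\<dots> = - sum g Y"
    by (subst sum.reindex) (auto simp: odd sum_negf)
  finally show ?thesis by simp
qed

lemma divide_eq_iff_eq_mult_divide:
  fixes a b s N :: real
  assumes "N > 0"
  shows "a / b = s / N \<longleftrightarrow> s = N * a / b"
proof -
  have "q = s / N \<longleftrightarrow> s = N * q" for q
    using assms by (auto simp: field_simps)
  from this[of "a / b"] show ?thesis by simp
qed

lemma spherical_design_3_iff:
  fixes Y :: "(real ^ 'm) set"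
  shows "spherical_design 3 Y \<longleftrightarrow> finite Y \<and> Y \<noteq> {} \<and> Y \<subseteq> sphere 0 1 \<and>
    (\<forall>v. (\<Sum>y\<in>Y. v \<bullet> y) = 0 \<and> (\<Sum>y\<in>Y. (v \<bullet> y)\<^sup>2) = card Y * (norm v)\<^sup>2 / CARD('m) \<and>
      (\<Sum>y\<in>Y. (v \<bullet> y) ^ 3) = 0)"
proof (cases "finite Y \<and> Y \<noteq> {}")
  case True
  then have N: "real (card Y) > 0"
    by (simp add: card_gt_0_iff)
  have 0: "(\<integral>x. (v \<bullet> x) ^ 0 \<partial>sphere_measure) = (\<Sum>y\<in>Y. (v \<bullet> y) ^ 0) / real (card Y)"
    for v :: "real ^ 'm"
    using N integral_sphere_measure_const[where 'a="real ^ 'm" and c=1] by simp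
  have 1: "(\<integral>x. (v \<bullet> x) ^ 1 \<partial>sphere_measure) = 0" for v :: "real ^ 'm"
    using sphere_moment_odd[of 1 v] by simp
  have cube: "(\<integral>x. (v \<bullet> x) ^ 3 \<partial>sphere_measure) = 0" for v :: "real ^ 'm"
    by (rule sphere_moment_odd) simp
  have c: "(norm v)\<^sup>2 / CARD('m) = s / real (card Y) \<longleftrightarrow> s = card Y * (norm v)\<^sup>2 / CARD('m)"
    for s and v :: "real ^ 'm"
    unfolding divide_eq_iff_eq_mult_divide[OF N] by (simp add: mult_ac)
  have c0: "0 = s / real (card Y) \<longleftrightarrow> s = 0" for s
    using N by auto
  have "(\<forall>k\<le>3. \<forall>v. (\<integral>x. (v \<bullet> x) ^ k \<partial>sphere_measure) = (\<Sum>y\<in>Y. (v \<bullet> y) ^ k) / real (card Y))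
    \<longleftrightarrow> (\<forall>v. (\<Sum>y\<in>Y. v \<bullet> y) = 0 \<and> (\<Sum>y\<in>Y. (v \<bullet> y)\<^sup>2) = card Y * (norm v)\<^sup>2 / CARD('m) \<and>
      (\<Sum>y\<in>Y. (v \<bullet> y) ^ 3) = 0)" (is "?L \<longleftrightarrow> ?R")
  proof
    assume L: ?L
    show ?R
    proof (intro allI conjI)
      fix v :: "real ^ 'm"
      show "(\<Sum>y\<in>Y. v \<bullet> y) = 0"
        using L[rule_format, of 1 v] by (simp only: 1 c0) simp
      show "(\<Sum>y\<in>Y. (v \<bullet> y)\<^sup>2) = card Y * (norm v)\<^sup>2 / CARD('m)"
        using L[rule_format, of 2 v] by (simp add: sphere_moment_2 c)
      show "(\<Sum>y\<in>Y. (v \<bullet> y) ^ 3) = 0"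
        using L[rule_format, of 3 v] by (simp add: cube c0)
    qed
  next
    assume R: ?R
    show ?L
    proof (intro allI impI)
      fix k :: nat and v :: "real ^ 'm" assume "k \<le> 3"
      then consider "k = 0" | "k = 1" | "k = 2" | "k = 3"
        by linarith
      then show "(\<integral>x. (v \<bullet> x) ^ k \<partial>sphere_measure) = (\<Sum>y\<in>Y. (v \<bullet> y) ^ k) / real (card Y)"
      proof cases
        case 2 with R 1 show ?thesis by simp
      next
        case 3 with R show ?thesis by (simp only: sphere_moment_2 c)
      next
        case 4 with R show ?thesis by (simp only: cube c0)
      qed (simp only: 0)
    qed
  qed
  then show ?thesis
    unfolding spherical_design_iff_moments by auto
qed (auto simp: spherical_design_def)

lemma antipodal_spherical_design_5_iff:
  fixes Y :: "(real ^ 'm) set"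
  assumes "antipodal Y"
  shows "spherical_design 5 Y \<longleftrightarrow> finite Y \<and> Y \<noteq> {} \<and> Y \<subseteq> sphere 0 1 \<and>
    (\<forall>v. (\<Sum>y\<in>Y. (v \<bullet> y)\<^sup>2) = card Y * (norm v)\<^sup>2 / CARD('m) \<and>
      (\<Sum>y\<in>Y. (v \<bullet> y) ^ 4) = 3 * card Y * norm v ^ 4 / (real CARD('m) * (real CARD('m) + 2)))"
proof (cases "finite Y \<and> Y \<noteq> {}")
  case True
  then have N: "real (card Y) > 0"
    by (simp add: card_gt_0_iff)
  have odd: "(\<integral>x. (v \<bullet> x) ^ k \<partial>sphere_measure) = (\<Sum>y\<in>Y. (v \<bullet> y) ^ k) / real (card Y)"
    if "odd k" for v :: "real ^ 'm" and k
    using sphere_moment_odd[OF that, of v] sum_antipodal_odd[OF assms, of "\<lambda>y. (v \<bullet> y) ^ k"] that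
    by simp
  have 0: "(\<integral>x. (v \<bullet> x) ^ 0 \<partial>sphere_measure) = (\<Sum>y\<in>Y. (v \<bullet> y) ^ 0) / real (card Y)"
    for v :: "real ^ 'm"
    using N integral_sphere_measure_const[where 'a="real ^ 'm" and c=1] by simp
  have c: "3 * norm v ^ 4 / real (CARD('m) * (CARD('m) + 2)) = s / real (card Y) \<longleftrightarrow>
      s = 3 * card Y * norm v ^ 4 / (real CARD('m) * (real CARD('m) + 2))" for s and v :: "real ^ 'm"
    unfolding divide_eq_iff_eq_mult_divide[OF N]
    by (simp only: of_nat_mult of_nat_add of_nat_numeral mult_ac)
  have c': "(norm v)\<^sup>2 / CARD('m) = s / real (card Y) \<longleftrightarrow> s = card Y * (norm v)\<^sup>2 / CARD('m)"
    for s and v :: "real ^ 'm"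
    unfolding divide_eq_iff_eq_mult_divide[OF N] by (simp add: mult_ac)
  have "(\<forall>k\<le>5. \<forall>v. (\<integral>x. (v \<bullet> x) ^ k \<partial>sphere_measure) = (\<Sum>y\<in>Y. (v \<bullet> y) ^ k) / real (card Y))
    \<longleftrightarrow> (\<forall>v. (\<Sum>y\<in>Y. (v \<bullet> y)\<^sup>2) = card Y * (norm v)\<^sup>2 / CARD('m) \<and>
      (\<Sum>y\<in>Y. (v \<bullet> y) ^ 4) = 3 * card Y * norm v ^ 4 / (real CARD('m) * (real CARD('m) + 2)))" (is "?L \<longleftrightarrow> ?R")
  proof
    assume L: ?L
    show ?R
    proof (intro allI conjI)
      fix v :: "real ^ 'm"
      show "(\<Sum>y\<in>Y. (v \<bullet> y)\<^sup>2) = card Y * (norm v)\<^sup>2 / CARD('m)"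
        using L[rule_format, of 2 v] by (simp add: sphere_moment_2 c')
      show "(\<Sum>y\<in>Y. (v \<bullet> y) ^ 4) = 3 * card Y * norm v ^ 4 / (real CARD('m) * (real CARD('m) + 2))"
        using L[rule_format, of 4 v] by (simp only: sphere_moment_4 c)
    qed
  next
    assume R: ?R
    show ?L
    proof (intro allI impI)
      fix k :: nat and v :: "real ^ 'm" assume "k \<le> 5"
      then have "k = 0 \<or> k = 2 \<or> k = 4 \<or> odd k"
        by presburger
      then consider "k = 0" | "k = 2" | "k = 4" | "odd k"
        by blast
      then show "(\<integral>x. (v \<bullet> x) ^ k \<partial>sphere_measure) = (\<Sum>y\<in>Y. (v \<bullet> y) ^ k) / real (card Y)"
      proof cases
        case 2 with R show ?thesis by (simp only: sphere_moment_2 c')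
      next
        case 3 with R show ?thesis by (simp only: sphere_moment_4 c)
      next
        case 4 then show ?thesis by (rule odd)
      qed (simp only: 0)
    qed
  qed
  then show ?thesis
    unfolding spherical_design_iff_moments by auto
qed (auto simp: spherical_design_def)

lemma quadratic_form_orthogonal:
  fixes Y :: "'a::real_inner set"
  assumes "\<And>v. (\<Sum>y\<in>Y. (v \<bullet> y)\<^sup>2) = C * (norm v)\<^sup>2" and "a \<bullet> w = 0"
  shows "(\<Sum>y\<in>Y. (a \<bullet> y) * (w \<bullet> y)) = 0"
proof -
  have "4 * (\<Sum>y\<in>Y. (a \<bullet> y) * (w \<bullet> y)) = (\<Sum>y\<in>Y. ((a + w) \<bullet> y)\<^sup>2) - (\<Sum>y\<in>Y. ((a - w) \<bullet> y)\<^sup>2)"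
    unfolding sum_subtractf[symmetric] sum_distrib_left
    by (intro sum.cong refl) (simp add: inner_simps power2_eq_square algebra_simps)
  also have "\<dots> = 0"
    unfolding assms(1) using assms(2) by (simp add: power2_norm_eq_inner inner_simps inner_commute)
  finally show ?thesis by simp
qed

lemma quartic_form_orthogonal:
  fixes Y :: "'a::real_inner set"
  assumes C: "\<And>v. (\<Sum>y\<in>Y. (v \<bullet> y) ^ 4) = C * norm v ^ 4" and aw: "a \<bullet> w = 0"
  shows "(\<Sum>y\<in>Y. (a \<bullet> y)\<^sup>2 * (w \<bullet> y)\<^sup>2) = C / 3 * (norm a)\<^sup>2 * (norm w)\<^sup>2"
    and "(\<Sum>y\<in>Y. (a \<bullet> y) * (w \<bullet> y) ^ 3) = 0"
proof -
  have n4: "norm v ^ 4 = (v \<bullet> v)\<^sup>2" for v :: 'a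
    by (simp add: power2_norm_eq_inner[symmetric])
  have C': "(\<Sum>y\<in>Y. (s * (a \<bullet> y) + t * (w \<bullet> y)) ^ 4) = C * (s\<^sup>2 * (a \<bullet> a) + t\<^sup>2 * (w \<bullet> w))\<^sup>2" for s t
    using C[of "s *\<^sub>R a + t *\<^sub>R w"] aw
    by (simp add: n4 inner_simps inner_commute power2_eq_square algebra_simps)
  define P Q R where "P = (\<Sum>y\<in>Y. (a \<bullet> y)\<^sup>2 * (w \<bullet> y)\<^sup>2)"
    and "Q = (\<Sum>y\<in>Y. (a \<bullet> y) * (w \<bullet> y) ^ 3)" and "R = (\<Sum>y\<in>Y. (a \<bullet> y) ^ 3 * (w \<bullet> y))"
  have e: "(\<Sum>y\<in>Y. (s * (a \<bullet> y) + t * (w \<bullet> y)) ^ 4)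
      = s ^ 4 * (\<Sum>y\<in>Y. (a \<bullet> y) ^ 4) + 4 * s ^ 3 * t * R + 6 * s\<^sup>2 * t\<^sup>2 * P + 4 * s * t ^ 3 * Q
        + t ^ 4 * (\<Sum>y\<in>Y. (w \<bullet> y) ^ 4)" for s t
  proof -
    have "(s * (a \<bullet> y) + t * (w \<bullet> y)) ^ 4 = s ^ 4 * (a \<bullet> y) ^ 4 + 4 * s ^ 3 * t * ((a \<bullet> y) ^ 3 * (w \<bullet> y))
      + 6 * s\<^sup>2 * t\<^sup>2 * ((a \<bullet> y)\<^sup>2 * (w \<bullet> y)\<^sup>2) + 4 * s * t ^ 3 * ((a \<bullet> y) * (w \<bullet> y) ^ 3)
        + t ^ 4 * (w \<bullet> y) ^ 4" for y
      by algebra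
    then show ?thesis
      unfolding P_def Q_def R_def by (simp only: sum.distrib sum_distrib_left)
  qed
  note E = C'[unfolded e]
  have "12 * P = 4 * C * (a \<bullet> a) * (w \<bullet> w)"
    using E[of 1 1] E[of 1 "-1"] E[of 1 0] E[of 0 1] by (simp add: power2_eq_square algebra_simps)
  then show "P = C / 3 * (norm a)\<^sup>2 * (norm w)\<^sup>2"
    by (simp add: power2_norm_eq_inner)
  show "Q = 0"
    using E[of 1 1] E[of 1 "-1"] E[of 2 1] E[of 2 "-1"] by (simp add: power2_eq_square algebra_simps)
qed

lemma sum_UNIV_quadruple:
  fixes g :: "'i::finite \<times> 'i \<times> 'i \<times> 'i \<Rightarrow> real"
  shows "(\<Sum>q\<in>UNIV. g q) = (\<Sum>i\<in>UNIV. \<Sum>j\<in>UNIV. \<Sum>k\<in>UNIV. \<Sum>l\<in>UNIV. g (i, j, k, l))"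
  by (simp add: sum.cartesian_product UNIV_Times_UNIV case_prod_beta')

text \<open>
  With \<open>T = (\<Sum>y\<in>Y. y\<^bold>\<otimes>y\<^bold>\<otimes>y\<^bold>\<otimes>y) - c S\<close>, where \<open>S\<close> is the isotropic symmetric tensor, the
  hypothesis says that \<open>T\<close> has norm zero.
\<close>

lemma quartic_form_isotropic:
  fixes Y :: "(real ^ 'm) set"
  assumes Y: "Y \<subseteq> sphere 0 1"
    and eq: "(\<Sum>x\<in>Y. \<Sum>y\<in>Y. (x \<bullet> y) ^ 4) = 3 * (real (card Y))\<^sup>2 / (real CARD('m) * (real CARD('m) + 2))"
  shows "(\<Sum>y\<in>Y. (v \<bullet> y) ^ 4) = 3 * card Y * norm v ^ 4 / (real CARD('m) * (real CARD('m) + 2))"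
proof -
  define p :: "real ^ 'm \<Rightarrow> real ^ ('m \<times> 'm \<times> 'm \<times> 'm)"
    where "p x = (\<chi> q. case q of (i, j, k, l) \<Rightarrow> x $ i * x $ j * x $ k * x $ l)" for x
  define S :: "real ^ ('m \<times> 'm \<times> 'm \<times> 'm)"
    where "S = (\<chi> q. case q of (i, j, k, l) \<Rightarrow>
      (if j = i then if l = k then 1 else 0 else 0) + (if k = i then if l = j then 1 else 0 else 0)
      + (if l = i then if k = j then 1 else 0 else 0))"
  have pp: "p x \<bullet> p y = (x \<bullet> y) ^ 4" for x y
  proof -
    have "p x \<bullet> p y = (\<Sum>i\<in>UNIV. \<Sum>j\<in>UNIV. \<Sum>k\<in>UNIV. \<Sum>l\<in>UNIV.
        (x $ i * y $ i) * ((x $ j * y $ j) * ((x $ k * y $ k) * (x $ l * y $ l))))"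
      unfolding inner_vec_def sum_UNIV_quadruple p_def
      by (simp only: prod.case vec_lambda_beta inner_real_def mult_ac)
    also have "\<dots> = (x \<bullet> y) * ((x \<bullet> y) * ((x \<bullet> y) * (x \<bullet> y)))"
      unfolding sum_distrib_left[symmetric] sum_distrib_right[symmetric] inner_vec_def inner_real_def ..
    finally show ?thesis by (simp add: power4_eq_xxxx mult.assoc)
  qed
  have S: "Z \<bullet> S = (\<Sum>i\<in>UNIV. \<Sum>k\<in>UNIV. Z $ (i, i, k, k) + Z $ (i, k, i, k) + Z $ (i, k, k, i))" for Z
  proof -
    have t: "z * ((if a then if b then 1 else 0 else 0) + (if c then if d then 1 else 0 else 0)
        + (if e then if f then 1 else 0 else 0))
      = (if a then if b then z else 0 else 0) + (if c then if d then z else 0 else 0)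
        + (if e then if f then z else (0::real) else 0)" for z a b c d e f
      by simp
    have i: "(\<Sum>x\<in>A. if b then g x else 0) = (if b then sum g A else (0::real))" for b A and g :: "'m \<Rightarrow> real"
      by simp
    show ?thesis
      unfolding inner_vec_def sum_UNIV_quadruple S_def
      by (simp add: t sum.distrib i)
  qed
  have pS: "p x \<bullet> S = 3 * norm x ^ 4" for x
  proof -
    have "p x \<bullet> S = (\<Sum>i\<in>UNIV. \<Sum>k\<in>UNIV. 3 * ((x $ i * x $ i) * (x $ k * x $ k)))"
      unfolding S p_def by (intro sum.cong refl) simp
    also have "\<dots> = 3 * ((x \<bullet> x) * (x \<bullet> x))"
      unfolding inner_vec_def sum_product by (simp only: sum_distrib_left inner_real_def)
    also have "\<dots> = 3 * norm x ^ 4"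
      by (simp add: power4_eq_xxxx power2_norm_eq_inner[symmetric] power2_eq_square)
    finally show ?thesis .
  qed
  have SS: "S \<bullet> S = 3 * (real CARD('m) * (real CARD('m) + 2))"
  proof -
    have "S \<bullet> S = (\<Sum>i\<in>(UNIV::'m set). \<Sum>k\<in>(UNIV::'m set). 3 + (if k = i then 6 else 0))"
      unfolding S[of S] by (intro sum.cong refl) (simp add: S_def)
    also have "\<dots> = 3 * (real CARD('m) * (real CARD('m) + 2))"
      by (simp add: sum.distrib algebra_simps)
    finally show ?thesis .
  qed
  define c where "c = card Y / (real CARD('m) * (real CARD('m) + 2))"
  have c: "c * (real CARD('m) * (real CARD('m) + 2)) = card Y"
  proof -
    have "real CARD('m) * (real CARD('m) + 2) \<noteq> 0"
      by (simp add: add_nonneg_eq_0_iff)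
    then show ?thesis unfolding c_def by (metis nonzero_eq_divide_eq)
  qed
  define T where "T = (\<Sum>y\<in>Y. p y) - c *\<^sub>R S"
  have TT: "T \<bullet> T = (\<Sum>y\<in>Y. \<Sum>x\<in>Y. p x \<bullet> p y) - 2 * c * (\<Sum>y\<in>Y. p y \<bullet> S) + c\<^sup>2 * (S \<bullet> S)"
  proof -
    have "T \<bullet> T = (\<Sum>y\<in>Y. p y) \<bullet> (\<Sum>y\<in>Y. p y) - 2 * c * ((\<Sum>y\<in>Y. p y) \<bullet> S) + c\<^sup>2 * (S \<bullet> S)"
      unfolding T_def
      by (simp add: inner_diff_left inner_diff_right inner_commute[of S "sum p Y"] power2_eq_square
          right_diff_distrib)
    then show ?thesis
      by (simp only: inner_sum_left inner_sum_right)
  qed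
  have e1: "(\<Sum>y\<in>Y. \<Sum>x\<in>Y. p x \<bullet> p y) = 3 * c * card Y"
    unfolding pp by (subst sum.swap, unfold eq) (simp add: c_def power2_eq_square)
  have "(\<Sum>y\<in>Y. p y \<bullet> S) = (\<Sum>y\<in>Y. 3)"
    using Y by (intro sum.cong refl) (auto simp: pS)
  then have e2: "(\<Sum>y\<in>Y. p y \<bullet> S) = 3 * card Y"
    by simp
  have e3: "c\<^sup>2 * (S \<bullet> S) = 3 * c * card Y"
    unfolding SS c[symmetric] by (simp add: power2_eq_square algebra_simps)
  have "T \<bullet> T = 0"
    unfolding TT e1 e2 e3 by simp
  then have "p v \<bullet> T = 0" by simp
  then have "(\<Sum>y\<in>Y. (v \<bullet> y) ^ 4) = 3 * c * norm v ^ 4"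
    unfolding T_def by (simp add: inner_simps inner_sum_right pp pS)
  then show ?thesis
    by (simp add: c_def)
qed

section \<open>Inner products in antipodal sets\<close>

lemma alpha_bounds:
  assumes "d > 4" and "real n > real d * (real d + 1) / 2"
  shows "alpha n d > 0" and "real n > real d"
    and "(alpha n d)\<^sup>2 * ((real d + 2) * (real n - real d)) = 3 * real n - real d * (real d + 2)"
    and "(alpha n d)\<^sup>2 * (real d + 2) > 1" and "(alpha n d)\<^sup>2 * (real d + 2) < 3"
proof -
  define D N where "D = real d" and "N = real n"
  have D: "D > 4" and N: "2 * N > D * (D + 1)"
    using assms by (auto simp: D_def N_def)
  have "D * 2 < D * (D + 1)"
    using D by (intro mult_strict_left_mono) auto
  with N have ND: "N > D" by simp
  then show "real n > real d"
    by (simp add: N_def D_def)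
  have "D * 3 < D * (D - 1)"
    using D by (intro mult_strict_left_mono) auto
  with N ND have pos: "3 * N - D * (D + 2) > N - D"
    using N D by (simp add: algebra_simps)
  have sq: "(alpha n d)\<^sup>2 = (3 * N - D * (D + 2)) / ((D + 2) * (N - D))"
    unfolding alpha_def D_def[symmetric] N_def[symmetric]
    by (intro real_sqrt_pow2 divide_nonneg_nonneg) (use D ND pos in auto)
  show "alpha n d > 0"
    unfolding alpha_def D_def[symmetric] N_def[symmetric]
    by (intro real_sqrt_gt_zero divide_pos_pos) (use D ND pos in auto)
  have sq': "(alpha n d)\<^sup>2 * ((D + 2) * (N - D)) = 3 * N - D * (D + 2)"
    unfolding sq using D ND by simp
  then show "(alpha n d)\<^sup>2 * ((real d + 2) * (real n - real d)) = 3 * real n - real d * (real d + 2)"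
    by (simp add: N_def D_def)
  have "((alpha n d)\<^sup>2 * (D + 2)) * (N - D) > 1 * (N - D)"
    using sq' pos by (simp add: mult.assoc)
  then show "(alpha n d)\<^sup>2 * (real d + 2) > 1"
    using ND by (simp add: D_def)
  have "D * 3 < D * (D + 2)"
    using D by (intro mult_strict_left_mono) auto
  then have "((alpha n d)\<^sup>2 * (D + 2)) * (N - D) < 3 * (N - D)"
    using sq' ND by (simp add: mult.assoc)
  then have "(alpha n d)\<^sup>2 * (D + 2) < 3"
    by (rule mult_right_less_imp_less) (use ND in simp)
  then show "(alpha n d)\<^sup>2 * (real d + 2) < 3"
    by (simp add: D_def)
qed

text \<open>
  The bounds on \<open>\<alpha>\<^sup>2\<close> leave only \<open>(d, n) = (8, 48)\<close> and \<open>(9, 108)\<close>, for which the number \<open>K\<close> of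
  points at inner product \<open>\<plusminus>\<alpha>\<close> from a given one would not be an integer.
\<close>

lemma alpha_neq:
  fixes K :: nat
  assumes d: "d > 4" and n: "real n > real d * (real d + 1) / 2"
    and K: "real K * (alpha n d)\<^sup>2 * real d = 2 * (real n - real d)"
  shows "(real d + 2) * alpha n d \<noteq> real d - 4"
proof
  assume eq: "(real d + 2) * alpha n d = real d - 4"
  have al: "(alpha n d)\<^sup>2 * (real d + 2)\<^sup>2 = (real d - 4)\<^sup>2"
    using eq by (metis mult.commute power_mult_distrib)
  have lo: "(real d - 4)\<^sup>2 > real d + 2"
    using mult_strict_right_mono[OF alpha_bounds(4)[OF d n], of "real d + 2"]
    by (simp add: mult.assoc al flip: power2_eq_square)
  have hi: "(real d - 4)\<^sup>2 < 3 * (real d + 2)"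
    using mult_strict_right_mono[OF alpha_bounds(5)[OF d n], of "real d + 2"]
    by (simp add: mult.assoc al flip: power2_eq_square)
  have "(real d - 1) * (real d - 10) < 0"
    using hi by (simp add: power2_eq_square algebra_simps)
  then have "d < 10"
    using d by (simp add: mult_less_0_iff)
  have "(real d - 2) * (real d - 7) > 0"
    using lo by (simp add: power2_eq_square algebra_simps)
  then have "d > 7"
    using d by (simp add: zero_less_mult_iff)
  with \<open>d < 10\<close> consider "d = 8" | "d = 9"
    by linarith
  then show False
  proof cases
    case 1
    then have a: "(alpha n 8)\<^sup>2 = 4 / 25"
      using al by simp
    have "real n = 48"
      using alpha_bounds(3)[OF d n] a by (simp add: 1)
    with K a have "real (2 * K) = real 125"
      by (simp add: 1)
    then have "2 * K = 125"
      unfolding of_nat_eq_iff .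
    then show False by presburger
  next
    case 2
    then have a: "(alpha n 9)\<^sup>2 = 25 / 121"
      using al by simp
    have "real n = 108"
      using alpha_bounds(3)[OF d n] a by (simp add: 2)
    with K a have "real (225 * K) = real 23958"
      by (simp add: 2)
    then have "225 * K = 23958"
      unfolding of_nat_eq_iff .
    then show False by presburger
  qed
qed

lemma unit_inner_eq_minus_1:
  fixes x y :: "'a::real_inner"
  assumes "norm x = 1" "norm y = 1" "x \<bullet> y = -1"
  shows "y = - x"
proof -
  have "x \<bullet> x = 1" "y \<bullet> y = 1"
    using assms by (simp_all flip: power2_norm_eq_inner)
  then have "(x + y) \<bullet> (x + y) = 0"
    using assms(3) by (simp add: inner_simps inner_commute)
  then have "x + y = 0"
    by simp
  then show ?thesis
    by (metis add.commute add_eq_0_iff)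
qed

lemma unit_neq_minus:
  fixes x :: "'a::real_inner"
  assumes "norm x = 1"
  shows "x \<noteq> - x"
proof
  assume "x = - x"
  then have "x \<bullet> x = - (x \<bullet> x)"
    by (metis inner_minus_left)
  then show False
    using assms by simp
qed

lemma inner_products_antipodal:
  fixes Y :: "'a::real_inner set"
  assumes "antipodal Y" "Y \<subseteq> sphere 0 1" "t \<in> inner_products Y Y" "t \<noteq> -1"
  shows "- t \<in> inner_products Y Y" "- t \<noteq> -1"
proof -
  obtain x y where xy: "x \<in> Y" "y \<in> Y" "x \<noteq> y" "t = x \<bullet> y"
    using assms(3) by (auto simp: inner_products_def)
  then have n: "norm x = 1" "norm y = 1"
    using assms(2) by auto
  have "- y \<in> Y"
    using xy assms(1) by (auto simp: antipodal_def)
  moreover have "x \<noteq> - y"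
    using n xy assms(4) by (auto simp flip: power2_norm_eq_inner)
  ultimately show "- t \<in> inner_products Y Y"
    using xy unfolding inner_products_def mem_Collect_eq by (metis inner_minus_right)
  show "- t \<noteq> -1"
    using unit_inner_eq_minus_1[of x "- y"] n xy by auto
qed

lemma minus_1_in_inner_products:
  fixes Y :: "'a::real_inner set"
  assumes "antipodal Y" "Y \<subseteq> sphere 0 1" "Y \<noteq> {}"
  shows "-1 \<in> inner_products Y Y"
proof -
  obtain x where x: "x \<in> Y" "norm x = 1"
    using assms by (metis all_not_in_conv dist_0_norm mem_sphere subsetD)
  then have "- x \<in> Y" "x \<noteq> - x" "x \<bullet> - x = -1"
    using assms(1) unit_neq_minus[of x] by (auto simp: antipodal_def simp flip: power2_norm_eq_inner)
  with x(1) show ?thesis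
    unfolding inner_products_def by force
qed

lemma antipodal_4_distance_set:
  fixes Y :: "'a::real_inner set"
  assumes "antipodal Y" "Y \<subseteq> sphere 0 1" "Y \<noteq> {}" "distance_set 4 Y"
  obtains b where "b > 0" "inner_products Y Y = {-1, 0, b, - b}"
proof -
  define B where "B = inner_products Y Y - {-1}"
  have m1: "-1 \<in> inner_products Y Y"
    using assms by (intro minus_1_in_inner_products)
  have "finite (inner_products Y Y)"
    using assms(4) by (intro card_ge_0_finite) (simp add: distance_set_def)
  then have fB: "finite B" and cB: "card B = 3"
    using m1 assms(4) by (auto simp: B_def distance_set_def)
  have sym: "- t \<in> B" if "t \<in> B" for t
    using that inner_products_antipodal[of Y t] assms by (auto simp: B_def)
  have "\<exists>b\<in>B. b \<noteq> 0"
  proof (rule ccontr)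
    assume "\<not> (\<exists>b\<in>B. b \<noteq> 0)"
    then have "B \<subseteq> {0}" by auto
    then have "card B \<le> 1"
      using card_mono[of "{0}" B] by simp
    then show False using cB by simp
  qed
  then obtain b where b: "b > 0" "b \<in> B"
    by (metis neg_0_less_iff_less linorder_neqE_linordered_idom sym)
  have "{b, - b} \<subseteq> B" "card {b, - b} = 2"
    using b sym by auto
  then have "card (B - {b, - b}) = 1"
    using fB cB by (subst card_Diff_subset) auto
  then obtain c where c: "B - {b, - b} = {c}"
    by (auto simp: card_1_singleton_iff)
  then have "c \<in> B" "c \<noteq> b" "c \<noteq> - b"
    by blast+
  then have "- c \<in> B - {b, - b}"
    using sym[of c] by auto
  then have "c = 0"
    unfolding c by simp
  then have "B = {0, b, - b}"
    using c \<open>{b, - b} \<subseteq> B\<close> by blast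
  then have "inner_products Y Y = {-1, 0, b, - b}"
    using m1 by (auto simp: B_def)
  with b(1) show ?thesis
    by (rule that)
qed

lemma sum_even_power_inner:
  fixes Y :: "'a::real_inner set" and b :: real
  assumes "finite Y" "antipodal Y" "Y \<subseteq> sphere 0 1" "inner_products Y Y \<subseteq> {-1, 0, b, - b}"
    and "x \<in> Y" "even m" "m > 0"
  shows "(\<Sum>y\<in>Y. (x \<bullet> y) ^ m) = 2 + card {y \<in> Y - {x, - x}. x \<bullet> y \<noteq> 0} * b ^ m"
proof -
  have nx: "norm x = 1" "x \<bullet> x = 1" "x \<noteq> - x" "- x \<in> Y"
    using assms unit_neq_minus[of x] by (auto simp: antipodal_def simp flip: power2_norm_eq_inner)
  have "(\<Sum>y\<in>Y. (x \<bullet> y) ^ m) = (\<Sum>y\<in>Y - {x, - x}. (x \<bullet> y) ^ m) + (\<Sum>y\<in>{x, - x}. (x \<bullet> y) ^ m)"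
    using assms nx by (intro sum.subset_diff) auto
  also have "(\<Sum>y\<in>{x, - x}. (x \<bullet> y) ^ m) = 2"
    using nx assms(6) by simp
  also have "(\<Sum>y\<in>Y - {x, - x}. (x \<bullet> y) ^ m) = (\<Sum>y\<in>Y - {x, - x}. if x \<bullet> y \<noteq> 0 then b ^ m else 0)"
  proof (intro sum.cong refl)
    fix y assume y: "y \<in> Y - {x, - x}"
    then have "x \<bullet> y \<in> inner_products Y Y"
      using assms(5) unfolding inner_products_def by blast
    moreover have "x \<bullet> y \<noteq> -1"
      using unit_inner_eq_minus_1[of x y] nx y assms(3) by auto
    ultimately have "x \<bullet> y = 0 \<or> x \<bullet> y = b \<or> x \<bullet> y = - b"
      using assms(4) by auto
    then show "(x \<bullet> y) ^ m = (if x \<bullet> y \<noteq> 0 then b ^ m else 0)"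
      using assms(6,7) by auto
  qed
  also have "\<dots> = card {y \<in> Y - {x, - x}. x \<bullet> y \<noteq> 0} * b ^ m"
    using assms(1) by (simp add: sum.If_cases Int_def)
  finally show ?thesis by simp
qed

lemma hyperplane_isometry:
  fixes e :: "real ^ 'd"
  assumes "CARD('e) = CARD('d) - 1" "e \<noteq> 0"
  obtains f :: "real ^ 'e \<Rightarrow> real ^ 'd"
    where "linear f" "\<And>x. norm (f x) = norm x" "range f = {x. e \<bullet> x = 0}"
proof -
  have "dim (UNIV :: (real ^ 'e) set) = dim {x. e \<bullet> x = 0}"
    using assms by (simp add: dim_hyperplane)
  then show ?thesis
  proof (rule isometries_subspaces[OF subspace_UNIV subspace_hyperplane])
    fix f :: "real ^ 'e \<Rightarrow> real ^ 'd" and g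
    assume "linear f" "range f = {x. e \<bullet> x = 0}" "\<And>x. x \<in> UNIV \<Longrightarrow> norm (f x) = norm x"
    then show ?thesis
      by (intro that) simp_all
  qed
qed

section \<open>Slices of the sphere\<close>

locale equator =
  fixes e :: "real ^ 'd" and f :: "real ^ 'e \<Rightarrow> real ^ 'd"
  assumes norm_e: "norm e = 1" and linear_f: "linear f"
    and norm_f: "\<And>x. norm (f x) = norm x" and range_f: "range f = {x. e \<bullet> x = 0}"
begin

definition lift :: "real \<Rightarrow> real ^ 'e \<Rightarrow> real ^ 'd" where
  "lift h y = h *\<^sub>R e + sqrt (1 - h\<^sup>2) *\<^sub>R f y"

lemma e_f [simp]: "e \<bullet> f y = 0" "f y \<bullet> e = 0"
  using range_f by (auto simp: inner_commute)

lemma e_e [simp]: "e \<bullet> e = 1"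
  using norm_e by (simp flip: power2_norm_eq_inner)

lemma f_f [simp]: "f x \<bullet> f y = x \<bullet> y"
proof -
  have "f (x + y) \<bullet> f (x + y) = (x + y) \<bullet> (x + y)" "f x \<bullet> f x = x \<bullet> x" "f y \<bullet> f y = y \<bullet> y"
    by (simp_all only: norm_f flip: power2_norm_eq_inner)
  then show ?thesis
    by (simp add: linear_add[OF linear_f] inner_simps inner_commute)
qed

lemma f_minus: "f (- y) = - f y"
  by (rule linear_neg[OF linear_f])

lemma lift_0 [simp]: "lift 0 y = f y"
  by (simp add: lift_def)

lemma lift_lift: "lift h x \<bullet> lift k y = h * k + sqrt (1 - h\<^sup>2) * sqrt (1 - k\<^sup>2) * (x \<bullet> y)"
  by (simp add: lift_def inner_simps)

lemma e_lift [simp]: "e \<bullet> lift h y = h"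
  by (simp add: lift_def inner_simps)

lemma f_lift: "f w \<bullet> lift h y = sqrt (1 - h\<^sup>2) * (w \<bullet> y)"
  by (simp add: lift_def inner_simps)

lemma lift_minus: "lift (- h) (- y) = - lift h y"
  by (simp add: lift_def f_minus)

lemma norm_lift:
  assumes "h\<^sup>2 < 1"
  shows "norm (lift h y) = 1 \<longleftrightarrow> norm y = 1"
proof -
  have "(norm (lift h y))\<^sup>2 - 1 = (1 - h\<^sup>2) * ((norm y)\<^sup>2 - 1)"
    using assms unfolding power2_norm_eq_inner
    by (simp add: lift_lift real_sqrt_mult_self abs_of_pos algebra_simps power2_eq_square[of h])
  then have "(norm (lift h y))\<^sup>2 = 1 \<longleftrightarrow> (norm y)\<^sup>2 = 1"
    using assms by auto
  then show ?thesis
    by (simp add: power2_eq_1_iff) (metis norm_ge_zero not_one_le_zero neg_0_le_iff_le)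
qed

lemma inj_lift:
  assumes "h\<^sup>2 < 1"
  shows "inj (lift h)"
proof (rule injI)
  fix x y assume "lift h x = lift h y"
  then have "f x = f y"
    using assms by (simp add: lift_def)
  then have "norm (f (x - y)) = 0"
    by (simp add: linear_diff[OF linear_f])
  then show "x = y"
    by (simp add: norm_f)
qed

lemma ex_lift:
  assumes "h\<^sup>2 < 1" "e \<bullet> z = h"
  shows "\<exists>y. z = lift h y"
proof -
  have "e \<bullet> (z - h *\<^sub>R e) = 0"
    using assms(2) by (simp add: inner_simps)
  then have "z - h *\<^sub>R e \<in> range f"
    by (simp add: range_f)
  then obtain y where y: "z - h *\<^sub>R e = f y"
    by auto
  define s where "s = sqrt (1 - h\<^sup>2)"
  have "s \<noteq> 0"
    using assms by (simp add: s_def)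
  then have "z = lift h (y /\<^sub>R s)"
    by (simp add: lift_def linear_cmul[OF linear_f] y[symmetric] flip: s_def)
  then show ?thesis ..
qed

lemma ex_decomposition: "\<exists>w. v = (e \<bullet> v) *\<^sub>R e + f w"
proof -
  have "v - (e \<bullet> v) *\<^sub>R e \<in> range f"
    by (simp add: range_f inner_simps)
  then obtain w where "v - (e \<bullet> v) *\<^sub>R e = f w"
    by auto
  then have "v = (e \<bullet> v) *\<^sub>R e + f w"
    by (simp add: algebra_simps)
  then show ?thesis ..
qed

lemma lift_vimage_image:
  assumes "h\<^sup>2 < 1"
  shows "lift h ` (lift h -` D) = {x \<in> D. e \<bullet> x = h}"
  using ex_lift[OF assms] by (auto simp: image_iff)

lemma sum_slice:
  assumes "h\<^sup>2 < 1" "finite D"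
  shows "(\<Sum>y\<in>lift h -` D. (w \<bullet> y) ^ k) * sqrt (1 - h\<^sup>2) ^ k
    = (\<Sum>x\<in>D. if e \<bullet> x = h then (f w \<bullet> x) ^ k else 0)"
proof -
  have "(\<Sum>y\<in>lift h -` D. (w \<bullet> y) ^ k) * sqrt (1 - h\<^sup>2) ^ k
      = (\<Sum>y\<in>lift h -` D. (f w \<bullet> lift h y) ^ k)"
    by (simp add: f_lift power_mult_distrib sum_distrib_left mult.commute)
  also have "\<dots> = (\<Sum>x\<in>lift h ` (lift h -` D). (f w \<bullet> x) ^ k)"
    by (subst sum.reindex) (auto intro: inj_on_subset[OF inj_lift[OF assms(1)]])
  also have "\<dots> = (\<Sum>x\<in>D. if e \<bullet> x = h then (f w \<bullet> x) ^ k else 0)"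
    unfolding lift_vimage_image[OF assms(1)] using assms(2) by (simp add: sum.inter_filter)
  finally show ?thesis .
qed

end

text \<open>
  The slices of a 5-design at the heights \<open>0, \<plusminus>h\<close> are 3-designs because their indicator functions
  are quadratic polynomials in the height.
\<close>

locale sliced_design = equator e f
  for e :: "real ^ 'd" and f :: "real ^ 'e \<Rightarrow> real ^ 'd" +
  fixes h :: real and D :: "(real ^ 'd) set"
  assumes cards: "CARD('e) = CARD('d) - 1" "CARD('d) > 4"
    and design: "spherical_design 5 D" and antip: "antipodal D"
    and heights: "\<And>x. x \<in> D \<Longrightarrow> e \<bullet> x \<in> {0, h, - h}"
    and h2: "h\<^sup>2 = 3 / (real CARD('d) + 2)"
begin

lemma finite_D: "finite D" and sphere_D: "D \<subseteq> sphere 0 1" and D_nonempty: "D \<noteq> {}"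
  and moment_2: "(\<Sum>x\<in>D. (v \<bullet> x)\<^sup>2) = card D * (norm v)\<^sup>2 / CARD('d)"
  and moment_4: "(\<Sum>x\<in>D. (v \<bullet> x) ^ 4) = 3 * card D * norm v ^ 4 / (real CARD('d) * (real CARD('d) + 2))"
  using design unfolding antipodal_spherical_design_5_iff[OF antip] by auto

lemma h2_less: "h\<^sup>2 < 1" and h_nz: "h \<noteq> 0" and one_minus_h2: "1 - h\<^sup>2 = (real CARD('d) - 1) / (real CARD('d) + 2)"
proof -
  have "real CARD('d) > 4"
    using cards by simp
  then show "h\<^sup>2 < 1" "1 - h\<^sup>2 = (real CARD('d) - 1) / (real CARD('d) + 2)"
    unfolding h2 by (simp_all add: field_simps)
  show "h \<noteq> 0"
    using h2 by (auto simp: add_nonneg_eq_0_iff)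
qed

lemma card_e: "real CARD('e) = real CARD('d) - 1"
  using cards by simp

lemma moment_e2: "(\<Sum>x\<in>D. (e \<bullet> x)\<^sup>2) = card D / CARD('d)"
  by (simp add: moment_2 norm_e)

lemma moment_f2: "(\<Sum>x\<in>D. (f w \<bullet> x)\<^sup>2) = card D * (norm w)\<^sup>2 / CARD('d)"
  by (simp add: moment_2 norm_f)

lemma moment_4_h: "(\<Sum>x\<in>D. (v \<bullet> x) ^ 4) = h\<^sup>2 * card D / CARD('d) * norm v ^ 4"
  unfolding moment_4 h2
  by (simp only: times_divide_eq_left times_divide_eq_right
      divide_divide_eq_left mult_ac)

lemma moment_e2_f2:
  "(\<Sum>x\<in>D. (e \<bullet> x)\<^sup>2 * (f w \<bullet> x)\<^sup>2) = h\<^sup>2 * (card D * (norm w)\<^sup>2 / (3 * CARD('d)))"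
  using quartic_form_orthogonal(1)[OF moment_4_h, of e "f w"] by (simp add: norm_e norm_f mult.commute)

lemma moment_e_f3: "(\<Sum>x\<in>D. (e \<bullet> x) * (f w \<bullet> x) ^ 3) = 0"
  using quartic_form_orthogonal(2)[OF moment_4_h, of e "f w"] by simp

lemma moment_e_f: "(\<Sum>x\<in>D. (e \<bullet> x) * (f w \<bullet> x)) = 0"
proof -
  have "(\<Sum>x\<in>D. (v \<bullet> x)\<^sup>2) = card D / CARD('d) * (norm v)\<^sup>2" for v
    unfolding moment_2 by simp
  from quadratic_form_orthogonal[OF this, of e "f w"] show ?thesis
    by simp
qed

lemma sum_odd: "(\<And>y. g (- y) = - g y) \<Longrightarrow> sum g D = (0 :: real)"
  using sum_antipodal_odd[OF antip] .

lemma sum_upper_slice: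
  "(\<Sum>y\<in>lift h -` D. (w \<bullet> y) ^ k) * sqrt (1 - h\<^sup>2) ^ k
    = (\<Sum>x\<in>D. (e \<bullet> x)\<^sup>2 * (f w \<bullet> x) ^ k) / (2 * h\<^sup>2) + (\<Sum>x\<in>D. (e \<bullet> x) * (f w \<bullet> x) ^ k) / (2 * h)"
proof -
  have "(if t = h then z else 0) = t\<^sup>2 * z / (2 * h\<^sup>2) + t * z / (2 * h)" if "t \<in> {0, h, - h}" for t z
    using that h_nz by (auto simp: field_simps power2_eq_square)
  then show ?thesis
    unfolding sum_slice[OF h2_less finite_D] sum_divide_distrib sum.distrib[symmetric]
    by (intro sum.cong refl) (use heights in auto)
qed

lemma sum_middle_slice:
  "(\<Sum>y\<in>lift 0 -` D. (w \<bullet> y) ^ k)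
    = (\<Sum>x\<in>D. (f w \<bullet> x) ^ k) - (\<Sum>x\<in>D. (e \<bullet> x)\<^sup>2 * (f w \<bullet> x) ^ k) / h\<^sup>2"
proof -
  have "(if t = 0 then z else 0) = z - t\<^sup>2 * z / h\<^sup>2" if "t \<in> {0, h, - h}" for t z
    using that h_nz by auto
  then have "(\<Sum>x\<in>D. if e \<bullet> x = 0 then (f w \<bullet> x) ^ k else 0)
      = (\<Sum>x\<in>D. (f w \<bullet> x) ^ k) - (\<Sum>x\<in>D. (e \<bullet> x)\<^sup>2 * (f w \<bullet> x) ^ k) / h\<^sup>2"
    unfolding sum_divide_distrib sum_subtractf[symmetric]
    by (intro sum.cong refl) (use heights in auto)
  then show ?thesis
    using sum_slice[of 0 D w k] finite_D by simp
qed

lemma slice_finite: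
  assumes "k\<^sup>2 < 1"
  shows "finite (lift k -` D)" "lift k -` D \<subseteq> sphere 0 1"
proof -
  show "finite (lift k -` D)"
    by (rule finite_vimageI[OF finite_D inj_lift[OF assms]])
  show "lift k -` D \<subseteq> sphere 0 1"
    using sphere_D norm_lift[OF assms] by auto
qed

lemma card_D_pos: "real (card D) > 0"
  using finite_D D_nonempty by (simp add: card_gt_0_iff)

lemma card_upper_slice:
  "real (card (lift h -` D)) = (real CARD('d) + 2) * real (card D) / (6 * real CARD('d))"
  using sum_upper_slice[of 0 0] sum_odd[of "\<lambda>x. e \<bullet> x"]
  by (simp add: moment_e2 h2 field_simps)

lemma card_middle_slice:
  "real (card (lift 0 -` D)) = 4 * (real CARD('d) - 1) * real (card D) / (6 * real CARD('d))"
  using sum_middle_slice[of 0 0]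
  by (simp add: moment_e2 h2 field_simps)

lemma upper_slice_design: "spherical_design 3 (lift h -` D)"
  unfolding spherical_design_3_iff
proof (intro conjI allI)
  show "finite (lift h -` D)" "lift h -` D \<subseteq> sphere 0 1"
    using slice_finite[OF h2_less] by auto
  show "lift h -` D \<noteq> {}"
    using card_upper_slice card_D_pos by (intro notI) (simp add: field_simps add_nonneg_eq_0_iff)
  fix w
  have r: "sqrt (1 - h\<^sup>2) \<noteq> 0"
    using h2_less by simp
  show "(\<Sum>y\<in>lift h -` D. w \<bullet> y) = 0"
    using sum_upper_slice[of w 1] r sum_odd[of "\<lambda>x. (e \<bullet> x)\<^sup>2 * (f w \<bullet> x)"] by (simp add: moment_e_f)
  show "(\<Sum>y\<in>lift h -` D. (w \<bullet> y) ^ 3) = 0"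
    using sum_upper_slice[of w 3] r sum_odd[of "\<lambda>x. (e \<bullet> x)\<^sup>2 * (f w \<bullet> x) ^ 3"] by (simp add: moment_e_f3)
  have "(\<Sum>y\<in>lift h -` D. (w \<bullet> y)\<^sup>2) * (1 - h\<^sup>2) = card D * (norm w)\<^sup>2 / (6 * CARD('d))"
    using sum_upper_slice[of w 2] h2_less h_nz sum_odd[of "\<lambda>x. (e \<bullet> x) * (f w \<bullet> x)\<^sup>2"]
    by (simp add: moment_e2_f2)
  moreover have "s = (m + 2) * N / (6 * m) * W / (m - 1)"
    if "s * ((m - 1) / (m + 2)) = N * W / (6 * m)" "m > 4" for s m N W :: real
    using that by (simp add: divide_simps) (simp add: algebra_simps)
  ultimately show "(\<Sum>y\<in>lift h -` D. (w \<bullet> y)\<^sup>2) = card (lift h -` D) * (norm w)\<^sup>2 / CARD('e)"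
    unfolding one_minus_h2 card_e card_upper_slice using cards by simp
qed

lemma middle_slice_design: "spherical_design 3 (lift 0 -` D)"
  unfolding spherical_design_3_iff
proof (intro conjI allI)
  show "finite (lift 0 -` D)" "lift 0 -` D \<subseteq> sphere 0 1"
    using slice_finite[of 0] by auto
  show "lift 0 -` D \<noteq> {}"
    using card_middle_slice card_D_pos cards by (intro notI) (simp add: field_simps)
  fix w
  show "(\<Sum>y\<in>lift 0 -` D. w \<bullet> y) = 0"
    using sum_middle_slice[of w 1] sum_odd[of "\<lambda>x. (e \<bullet> x)\<^sup>2 * (f w \<bullet> x)"] sum_odd[of "\<lambda>x. f w \<bullet> x"]
    by simp
  show "(\<Sum>y\<in>lift 0 -` D. (w \<bullet> y) ^ 3) = 0"
    using sum_middle_slice[of w 3] sum_odd[of "\<lambda>x. (e \<bullet> x)\<^sup>2 * (f w \<bullet> x) ^ 3"] sum_odd[of "\<lambda>x. (f w \<bullet> x) ^ 3"]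
    by simp
  have "(\<Sum>y\<in>lift 0 -` D. (w \<bullet> y)\<^sup>2) = 4 * card D * (norm w)\<^sup>2 / (6 * CARD('d))"
    using sum_middle_slice[of w 2]      h_nz by (simp add: moment_e2_f2 moment_f2 field_simps)
  moreover have "4 * N * W / (6 * m) = 4 * (m - 1) * N / (6 * m) * W / (m - 1)" if "m > 4" for m N W :: real
    using that by (simp add: divide_simps)
  ultimately show "(\<Sum>y\<in>lift 0 -` D. (w \<bullet> y)\<^sup>2) = card (lift 0 -` D) * (norm w)\<^sup>2 / CARD('e)"
    unfolding card_e card_middle_slice using cards by simp
qed

end

context sliced_design
begin

lemma minus_slice: "uminus ` (lift k -` D) = lift (- k) -` D"
proof -
  have m: "- x \<in> D \<longleftrightarrow> x \<in> D" for x
    using antip unfolding antipodal_def by (metis image_eqI minus_minus)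
  show ?thesis
  proof (intro set_eqI iffI)
    fix y assume "y \<in> lift (- k) -` D"
    then have "- y \<in> lift k -` D"
      using m[of "lift k (- y)"] lift_minus[of k "- y"] by simp
    then show "y \<in> uminus ` (lift k -` D)"
      by (metis image_eqI minus_minus)
  qed (auto simp: lift_minus m)
qed

lemma inner_products_slices:
  assumes "y \<in> lift k -` D" "z \<in> lift l -` D" "k \<noteq> l \<or> y \<noteq> z" "k\<^sup>2 < 1" "l\<^sup>2 < 1"
  shows "k * l + sqrt (1 - k\<^sup>2) * sqrt (1 - l\<^sup>2) * (y \<bullet> z) \<in> inner_products D D"
    and "l \<noteq> - k \<Longrightarrow> k * l + sqrt (1 - k\<^sup>2) * sqrt (1 - l\<^sup>2) * (y \<bullet> z) \<noteq> -1"
proof -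
  have D: "lift k y \<in> D" "lift l z \<in> D"
    using assms by auto
  have "lift k y \<noteq> lift l z"
  proof
    assume eq: "lift k y = lift l z"
    then have "k = l"
      using e_lift by metis
    with eq assms(3,4) show False
      using inj_lift[of k] by (auto dest: injD)
  qed
  with D have "lift k y \<bullet> lift l z \<in> inner_products D D"
    unfolding inner_products_def by blast
  then show "k * l + sqrt (1 - k\<^sup>2) * sqrt (1 - l\<^sup>2) * (y \<bullet> z) \<in> inner_products D D"
    by (simp add: lift_lift)
  assume "l \<noteq> - k"
  show "k * l + sqrt (1 - k\<^sup>2) * sqrt (1 - l\<^sup>2) * (y \<bullet> z) \<noteq> -1"
  proof
    assume "k * l + sqrt (1 - k\<^sup>2) * sqrt (1 - l\<^sup>2) * (y \<bullet> z) = -1"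
    then have i: "lift k y \<bullet> lift l z = -1"
      by (simp only: lift_lift)
    have n: "norm (lift k y) = 1" "norm (lift l z) = 1"
      using D sphere_D by auto
    have "lift l z = - lift k y"
      by (rule unit_inner_eq_minus_1[OF n i])
    then have "e \<bullet> lift l z = - (e \<bullet> lift k y)"
      by simp
    then show False
      using \<open>l \<noteq> - k\<close> by simp
  qed
qed

lemma inner_products_outer_slice:
  assumes "inner_products D D \<subseteq> {-1, 0, b, - b}" "k = h \<or> k = - h"
  shows "inner_products (lift k -` D) (lift k -` D) \<subseteq>
    {- (3 / (real CARD('d) - 1)), ((real CARD('d) + 2) * b - 3) / (real CARD('d) - 1),
     (- ((real CARD('d) + 2) * b) - 3) / (real CARD('d) - 1)}"
proof
  fix p assume "p \<in> inner_products (lift k -` D) (lift k -` D)"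
  then obtain y z where yz: "y \<in> lift k -` D" "z \<in> lift k -` D" "y \<noteq> z" "p = y \<bullet> z"
    unfolding inner_products_def by blast
  have k2: "k\<^sup>2 = h\<^sup>2" "k \<noteq> - k"
    using assms(2) h_nz by auto
  define m where "m = real CARD('d)"
  have m: "m > 4"
    using cards by (simp add: m_def)
  have s: "sqrt (1 - k\<^sup>2) * sqrt (1 - k\<^sup>2) = (m - 1) / (m + 2)" "k * k = 3 / (m + 2)"
    using h2_less unfolding k2 power2_eq_square[symmetric]
    by (simp_all add: h2 m_def flip: one_minus_h2)
  have k1: "k\<^sup>2 < 1"
    using k2 h2_less by simp
  have "3 / (m + 2) + (m - 1) / (m + 2) * p \<in> inner_products D D - {-1}"
    using inner_products_slices[OF yz(1,2) disjI2[OF yz(3)] k1 k1] k2(2) unfolding s yz(4) by blast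
  then have "3 / (m + 2) + (m - 1) / (m + 2) * p \<in> {0, b, - b}"
    using assms(1) by blast
  moreover have "p = ((m + 2) * t - 3) / (m - 1)" if "3 / (m + 2) + (m - 1) / (m + 2) * p = t" for t
  proof -
    have "(3 + (m - 1) * p) / (m + 2) = t"
      using that by (simp add: add_divide_distrib)
    then have "3 + (m - 1) * p = (m + 2) * t"
      using m by (simp add: divide_eq_eq mult.commute)
    then show ?thesis
      using m by (simp add: eq_divide_eq mult.commute)
  qed
  ultimately show "p \<in> {- (3 / (real CARD('d) - 1)), ((real CARD('d) + 2) * b - 3) / (real CARD('d) - 1),
     (- ((real CARD('d) + 2) * b) - 3) / (real CARD('d) - 1)}"
    unfolding m_def[symmetric] by force
qed

lemma inner_products_opposite_slices:
  assumes "inner_products D D \<subseteq> {-1, 0, b, - b}"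
  shows "inner_products (lift h -` D) (lift (- h) -` D) \<subseteq>
    {-1, 3 / (real CARD('d) - 1), ((real CARD('d) + 2) * b + 3) / (real CARD('d) - 1),
     (- ((real CARD('d) + 2) * b) + 3) / (real CARD('d) - 1)}"
proof
  fix p assume "p \<in> inner_products (lift h -` D) (lift (- h) -` D)"
  then obtain y z where yz: "y \<in> lift h -` D" "z \<in> lift (- h) -` D" "y \<noteq> z" "p = y \<bullet> z"
    unfolding inner_products_def by blast
  define m where "m = real CARD('d)"
  have m: "m > 4"
    using cards by (simp add: m_def)
  have s: "sqrt (1 - h\<^sup>2) * sqrt (1 - h\<^sup>2) = (m - 1) / (m + 2)" "h * h = 3 / (m + 2)"
    using h2_less unfolding power2_eq_square[symmetric]
    by (simp_all add: h2 m_def flip: one_minus_h2)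
  have "(- h)\<^sup>2 < 1"
    using h2_less by simp
  from inner_products_slices(1)[OF yz(1,2) disjI2[OF yz(3)] h2_less this]
  have "(m - 1) / (m + 2) * p - 3 / (m + 2) \<in> inner_products D D"
    using s yz(4) by simp
  then have "(m - 1) / (m + 2) * p - 3 / (m + 2) \<in> {-1, 0, b, - b}"
    using assms(1) by blast
  moreover have "p = ((m + 2) * t + 3) / (m - 1)" if "(m - 1) / (m + 2) * p - 3 / (m + 2) = t" for t
    using that m by (simp add: divide_simps) (simp add: algebra_simps)
  moreover have "((m + 2) * (-1) + 3) / (m - 1) = -1"
    using m by (simp add: divide_simps)
  ultimately show "p \<in> {-1, 3 / (real CARD('d) - 1), ((real CARD('d) + 2) * b + 3) / (real CARD('d) - 1),
     (- ((real CARD('d) + 2) * b) + 3) / (real CARD('d) - 1)}"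
    unfolding m_def[symmetric] by force
qed

lemma inner_products_middle_slice:
  assumes "inner_products D D \<subseteq> {-1, 0, b, - b}"
  shows "inner_products (lift 0 -` D) (lift 0 -` D) \<subseteq> {-1, 0, b, - b}"
proof
  fix p assume "p \<in> inner_products (lift 0 -` D) (lift 0 -` D)"
  then obtain y z where yz: "y \<in> lift 0 -` D" "z \<in> lift 0 -` D" "y \<noteq> z" "p = y \<bullet> z"
    unfolding inner_products_def by blast
  show "p \<in> {-1, 0, b, - b}"
    using inner_products_slices(1)[OF yz(1,2)] yz(3,4) assms by auto
qed

lemma inner_products_adjacent_slices:
  assumes "inner_products D D \<subseteq> {-1, 0, b, - b}" "k = h \<or> k = - h"
  shows "inner_products (lift k -` D) (lift 0 -` D) \<subseteq>
    {0, sqrt ((real CARD('d) + 2) / (real CARD('d) - 1)) * b,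
     - (sqrt ((real CARD('d) + 2) / (real CARD('d) - 1)) * b)}"
proof
  fix p assume "p \<in> inner_products (lift k -` D) (lift 0 -` D)"
  then obtain y z where yz: "y \<in> lift k -` D" "z \<in> lift 0 -` D" "y \<noteq> z" "p = y \<bullet> z"
    unfolding inner_products_def by blast
  have k2: "k\<^sup>2 = h\<^sup>2" "k \<noteq> 0"
    using assms(2) h_nz by auto
  define r where "r = sqrt (1 - h\<^sup>2)"
  have r: "r > 0"
    using h2_less by (simp add: r_def)
  have r': "sqrt ((real CARD('d) + 2) / (real CARD('d) - 1)) = 1 / r"
    unfolding r_def one_minus_h2 by (simp add: real_sqrt_divide)
  have k1: "k\<^sup>2 < 1" "(0::real)\<^sup>2 < 1"
    using k2 h2_less by simp_all
  have "r * p \<in> inner_products D D - {-1}"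
    using inner_products_slices[OF yz(1,2) disjI2[OF yz(3)] k1] k2 yz(4) by (simp add: r_def)
  then have "r * p \<in> {0, b, - b}"
    using assms(1) by blast
  then show "p \<in> {0, sqrt ((real CARD('d) + 2) / (real CARD('d) - 1)) * b,
     - (sqrt ((real CARD('d) + 2) / (real CARD('d) - 1)) * b)}"
    unfolding r' using r by (auto simp: field_simps)
qed

end

lemma inner_products_commute: "inner_products Y Z = inner_products Z Y"
  unfolding inner_products_def by (rule Collect_cong) (metis inner_commute)

lemma minimal_type_vector_norm:
  fixes D :: "(real ^ 'd) set"
  assumes "spherical_design 5 D" "antipodal D" "a \<noteq> 0" "\<forall>x\<in>D. a \<bullet> x \<in> {0, 1, -1}"
  shows "(norm a)\<^sup>2 = (real CARD('d) + 2) / 3"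
proof -
  define m N where "m = real CARD('d)" and "N = real (card D)"
  have pos: "m > 0" "N > 0" "(norm a)\<^sup>2 > 0"
    using assms by (auto simp: m_def N_def spherical_design_def card_gt_0_iff)
  have "(\<Sum>x\<in>D. (a \<bullet> x) ^ 4) = (\<Sum>x\<in>D. (a \<bullet> x)\<^sup>2)"
    using assms(4) by (intro sum.cong refl) auto
  then have "3 * N * norm a ^ 4 / (m * (m + 2)) = N * (norm a)\<^sup>2 / m"
    using assms(1) unfolding antipodal_spherical_design_5_iff[OF assms(2)] m_def N_def by simp
  then have "3 * N * ((norm a)\<^sup>2 * (norm a)\<^sup>2) / (m * (m + 2)) = N * (norm a)\<^sup>2 / m"
    by (simp flip: power_add)
  moreover have "A = (m + 2) / 3" if "3 * N * (A * A) / (m * (m + 2)) = N * A / m" "A > 0" for A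
    using that pos by (simp add: divide_simps)
  ultimately show ?thesis
    using pos unfolding m_def[symmetric] by blast
qed

lemma antipodal_design_inner_product:
  fixes D :: "(real ^ 'd) set"
  assumes D: "spherical_design 5 D" "antipodal D" "card D = 2 * n"
    and b: "b > 0" "inner_products D D \<subseteq> {-1, 0, b, - b}"
    and d: "CARD('d) > 4" "real n > real CARD('d) * (real CARD('d) + 1) / 2"
  shows "b = alpha n CARD('d)"
    and "\<exists>K::nat. real K * (alpha n CARD('d))\<^sup>2 * real CARD('d) = 2 * (real n - real CARD('d))"
proof -
  define m N where "m = real CARD('d)" and "N = real n"
  note al = alpha_bounds[OF d, folded m_def N_def]
  have m: "m > 4"
    using d by (simp add: m_def)
  have D': "finite D" "D \<noteq> {}" "D \<subseteq> sphere 0 1"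
    and m2: "(\<Sum>y\<in>D. (v \<bullet> y)\<^sup>2) = 2 * N * (norm v)\<^sup>2 / m"
    and m4: "(\<Sum>y\<in>D. (v \<bullet> y) ^ 4) = 6 * N * norm v ^ 4 / (m * (m + 2))" for v
    using D(1,3) unfolding antipodal_spherical_design_5_iff[OF D(2)] m_def N_def by auto
  obtain x where x: "x \<in> D" "norm x = 1"
    using D' by (metis all_not_in_conv dist_0_norm mem_sphere subsetD)
  define K where "K = card {y \<in> D - {x, - x}. x \<bullet> y \<noteq> 0}"
  note s = sum_even_power_inner[OF D'(1) D(2) D'(3) b(2) x(1), folded K_def]
  have e2: "K * b\<^sup>2 * m = 2 * (N - m)"
    using s[of 2] m m2[of x] x by (simp add: field_simps)
  have "(2 + K * b ^ 4) * (m * (m + 2)) = 6 * N"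
    using s[of 4] m m4[of x] x by (simp add: divide_eq_eq)
  then have "(K * b\<^sup>2 * m) * (b\<^sup>2 * (m + 2)) = 6 * N - 2 * (m * (m + 2))"
    by (simp add: power4_eq_xxxx power2_eq_square algebra_simps)
  then have "b\<^sup>2 * ((m + 2) * (N - m)) = 3 * N - m * (m + 2)"
    unfolding e2 by (simp add: algebra_simps)
  then have "b\<^sup>2 * ((m + 2) * (N - m)) = (alpha n CARD('d))\<^sup>2 * ((m + 2) * (N - m))"
    using al(3) by simp
  then have "b\<^sup>2 = (alpha n CARD('d))\<^sup>2"
    using al(2) m by simp
  then show "b = alpha n CARD('d)"
    using b(1) al(1) by (simp add: power2_eq_iff)
  with e2 show "\<exists>K::nat. real K * (alpha n CARD('d))\<^sup>2 * real CARD('d) = 2 * (real n - real CARD('d))"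
    unfolding m_def N_def by blast
qed

section \<open>Gluing slices\<close>

context equator
begin

lemma antipodal_5_design_of_slices:
  fixes X1 X2 :: "(real ^ 'e) set" and n :: nat
  defines "a \<equiv> alpha n CARD('d)"
  assumes cards: "CARD('e) = CARD('d) - 1" "CARD('d) > 4"
    and n: "real n > real CARD('d) * (real CARD('d) + 1) / 2"
    and h: "h\<^sup>2 = 3 / (real CARD('d) + 2)"
    and X1: "spherical_design 3 X1" and X2: "spherical_design 3 X2" "X2 = uminus ` X2"
    and c1: "real (card X1) = (real CARD('d) + 2) * real n / (3 * real CARD('d))"
    and c2: "real (card X2) = 4 * (real CARD('d) - 1) * real n / (3 * real CARD('d))"
    and i11: "inner_products X1 X1 \<subseteq>
      {- (3 / (real CARD('d) - 1)), ((real CARD('d) + 2) * a - 3) / (real CARD('d) - 1),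
       (- ((real CARD('d) + 2) * a) - 3) / (real CARD('d) - 1)}"
    and i22: "inner_products X2 X2 \<subseteq> {-1, 0, a, - a}"
    and i12: "inner_products X1 X2 \<subseteq>
      {0, sqrt ((real CARD('d) + 2) / (real CARD('d) - 1)) * a,
       - (sqrt ((real CARD('d) + 2) / (real CARD('d) - 1)) * a)}"
  shows "\<exists>D :: (real ^ 'd) set.
    spherical_design 5 D \<and> antipodal D \<and> distance_set 4 D \<and> card D = 2 * n \<and> minimal_type D"
proof -
  define m N where "m = real CARD('d)" and "N = real n"
  have m: "m > 4" and card_e: "real CARD('e) = m - 1"
    using cards by (simp_all add: m_def)
  note al = alpha_bounds[OF cards(2) n, folded m_def N_def a_def]
  note h = h[folded m_def] and c1 = c1[folded m_def N_def] and c2 = c2[folded m_def N_def]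
  have h1: "h\<^sup>2 < 1" and hnz: "h \<noteq> 0"
    using h m by auto
  define r where "r = sqrt (1 - h\<^sup>2)"
  have r2: "r\<^sup>2 = (m - 1) / (m + 2)" and r: "r > 0"
    using h1 m unfolding r_def by (simp_all add: h field_simps)
  have rs: "sqrt ((m + 2) / (m - 1)) = 1 / r"
  proof -
    have "(m + 2) / (m - 1) = (1 / r)\<^sup>2"
      using r2 by (simp add: power_divide)
    then show ?thesis
      using r by simp
  qed
  have X1': "finite X1" "X1 \<subseteq> sphere 0 1" "\<And>w. (\<Sum>y\<in>X1. w \<bullet> y) = 0"
    "\<And>w. (\<Sum>y\<in>X1. (w \<bullet> y)\<^sup>2) = card X1 * (norm w)\<^sup>2 / (m - 1)"
    using X1 unfolding spherical_design_3_iff card_e by auto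
  have X2': "finite X2" "X2 \<subseteq> sphere 0 1"
    "\<And>w. (\<Sum>y\<in>X2. (w \<bullet> y)\<^sup>2) = card X2 * (norm w)\<^sup>2 / (m - 1)"
    using X2 unfolding spherical_design_3_iff card_e by auto
  define L1 L2 where "L1 = lift h ` X1" and "L2 = f ` X2"
  define D where "D = L1 \<union> uminus ` L1 \<union> L2"
  have minus_X2: "- y \<in> X2" if "y \<in> X2" for y
    using that X2(2) by (metis imageI)
  have minus_L2: "- y \<in> L2" if "y \<in> L2" for y
    using that minus_X2 unfolding L2_def by (auto simp flip: f_minus)
  have minus_D: "- y \<in> D" if "y \<in> D" for y
    using that minus_L2 unfolding D_def by auto
  have antip: "antipodal D"
    unfolding antipodal_def
  proof (intro equalityI subsetI)
    fix y assume "y \<in> D"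
    then show "y \<in> uminus ` D"
      using minus_D[of y] by (metis image_eqI minus_minus)
  qed (use minus_D in auto)
  have fin: "finite D"
    using X1' X2' by (simp add: D_def L1_def L2_def)
  have sph: "D \<subseteq> sphere 0 1"
    using X1'(2) X2'(2) norm_lift[OF h1] unfolding D_def L1_def L2_def by (auto simp: norm_f)
  have e_L: "x \<in> L1 \<Longrightarrow> e \<bullet> x = h" "x \<in> L2 \<Longrightarrow> e \<bullet> x = 0" "x \<in> uminus ` L1 \<Longrightarrow> e \<bullet> x = - h" for x
    by (auto simp: L1_def L2_def)
  have disj: "L1 \<inter> uminus ` L1 = {}" "(L1 \<union> uminus ` L1) \<inter> L2 = {}"
    using e_L hnz by fastforce+
  have inj1: "inj_on (lift h) X1" and inj2: "inj_on f X2"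
    using inj_lift[OF h1] inj_lift[of 0] by (auto intro: inj_on_subset simp: lift_0[abs_def])
  have sum_D: "sum g D = 2 * (\<Sum>y\<in>X1. g (lift h y)) + (\<Sum>y\<in>X2. g (f y))"
    if "\<And>x. g (- x) = g x" for g :: "real ^ 'd \<Rightarrow> real"
  proof -
    have "sum g D = sum g L1 + sum g (uminus ` L1) + sum g L2"
      using disj X1'(1) X2'(1) unfolding D_def by (simp add: sum.union_disjoint L1_def L2_def)
    also have "sum g (uminus ` L1) = sum g L1"
      by (subst sum.reindex) (auto simp: that)
    also have "sum g L1 = (\<Sum>y\<in>X1. g (lift h y))"
      unfolding L1_def by (subst sum.reindex[OF inj1]) simp
    also have "sum g L2 = (\<Sum>y\<in>X2. g (f y))"
      unfolding L2_def by (subst sum.reindex[OF inj2]) simp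
    finally show ?thesis by simp
  qed
  have "real (card D) = 2 * N"
  proof -
    have "real (card D) = 2 * real (card X1) + real (card X2)"
      using sum_D[of "\<lambda>_. 1"] by simp
    also have "\<dots> = 2 * N"
      unfolding c1 c2 using m by (simp add: field_simps)
    finally show ?thesis .
  qed
  then have card_D: "card D = 2 * n"
    by (simp add: N_def)
  have moment_2: "(\<Sum>x\<in>D. (v \<bullet> x)\<^sup>2) = 2 * N * (norm v)\<^sup>2 / m" for v
  proof -
    define s where "s = e \<bullet> v"
    obtain w where v: "v = s *\<^sub>R e + f w"
      using ex_decomposition[of v] unfolding s_def by blast
    have nv: "(norm v)\<^sup>2 = s\<^sup>2 + (norm w)\<^sup>2"
      unfolding v power2_norm_eq_inner by (simp add: inner_simps power2_eq_square)
    have vh: "v \<bullet> lift h y = s * h + r * (w \<bullet> y)" for y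
      by (simp add: v inner_add_left f_lift r_def)
    have "(\<Sum>y\<in>X1. (v \<bullet> lift h y)\<^sup>2)
        = (\<Sum>y\<in>X1. (s * h)\<^sup>2 + (2 * s * h * r) * (w \<bullet> y) + r\<^sup>2 * (w \<bullet> y)\<^sup>2)"
      by (intro sum.cong refl) (simp only: vh, algebra)
    also have "\<dots> = card X1 * (s * h)\<^sup>2 + r\<^sup>2 * (card X1 * (norm w)\<^sup>2 / (m - 1))"
      by (simp only: sum.distrib sum_distrib_left[symmetric] X1'(3,4) sum_constant mult_zero_right add_0_right)
    finally have s1: "(\<Sum>y\<in>X1. (v \<bullet> lift h y)\<^sup>2)
      = card X1 * (s * h)\<^sup>2 + r\<^sup>2 * (card X1 * (norm w)\<^sup>2 / (m - 1))" .
    have s2: "(\<Sum>y\<in>X2. (v \<bullet> f y)\<^sup>2) = card X2 * (norm w)\<^sup>2 / (m - 1)"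
      by (simp add: v inner_add_left X2')
    have arith: "2 * ((m + 2) * N / (3 * m) * (S * (3 / (m + 2)))
          + (m - 1) / (m + 2) * ((m + 2) * N / (3 * m) * W / (m - 1)))
        + 4 * (m - 1) * N / (3 * m) * W / (m - 1) = 2 * N * (S + W) / m" for S W
      using m by (simp add: divide_simps) (simp add: algebra_simps)
    have "(\<Sum>x\<in>D. (v \<bullet> x)\<^sup>2) = 2 * (\<Sum>y\<in>X1. (v \<bullet> lift h y)\<^sup>2) + (\<Sum>y\<in>X2. (v \<bullet> f y)\<^sup>2)"
      by (rule sum_D) simp
    also have "\<dots> = 2 * N * (norm v)\<^sup>2 / m"
      unfolding s1 s2 nv power_mult_distrib h r2 c1 c2 by (rule arith)
    finally show ?thesis .
  qed
  have inner_L: "x \<bullet> y \<in> {1, -1, 0, a, - a}" if xy: "x \<in> L1 \<union> L2" "y \<in> L1 \<union> L2" for x y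
  proof -
    have 11: "lift h x \<bullet> lift h y \<in> {1, -1, 0, a, - a}" if xy: "x \<in> X1" "y \<in> X1" for x y
    proof (cases "x = y")
      case True
      then have "norm (lift h x) = 1"
        using X1'(2) xy norm_lift[OF h1] by auto
      then show ?thesis
        using True by (simp flip: power2_norm_eq_inner)
    next
      case False
      then have "x \<bullet> y \<in> inner_products X1 X1"
        using xy unfolding inner_products_def by blast
      then have "x \<bullet> y \<in> {((m + 2) * 0 - 3) / (m - 1), ((m + 2) * a - 3) / (m - 1), ((m + 2) * (- a) - 3) / (m - 1)}"
        using i11 unfolding m_def[symmetric] by auto
      then obtain t where t: "t \<in> {0, a, - a}" "x \<bullet> y = ((m + 2) * t - 3) / (m - 1)"
        by blast
      have "lift h x \<bullet> lift h y = 3 / (m + 2) + (m - 1) / (m + 2) * (((m + 2) * t - 3) / (m - 1))"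
        unfolding lift_lift t(2) r_def[symmetric] by (simp flip: power2_eq_square h r2)
      also have "\<dots> = t"
        using m by (simp add: divide_simps) (simp add: algebra_simps)
      finally show ?thesis
        using t(1) by auto
    qed
    have 12: "lift h x \<bullet> f y \<in> {1, -1, 0, a, - a}" if xy: "x \<in> X1" "y \<in> X2" for x y
    proof -
      have ra: "x \<bullet> y \<in> {0, a / r, - (a / r)}" if "x \<in> X1" "y \<in> X2" "x \<noteq> y" for x y
      proof -
        have "x \<bullet> y \<in> inner_products X1 X2"
          using that unfolding inner_products_def by blast
        then show ?thesis
          using i12 unfolding m_def[symmetric] rs by auto
      qed
      have "x \<noteq> y"
      proof
        assume eq: "x = y"
        have nx: "norm x = 1"
          using xy X1'(2) by auto
        then have "x \<bullet> - x \<in> {0, a / r, - (a / r)}"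
          using xy minus_X2 unit_neq_minus[OF nx] eq by (intro ra) auto
        moreover have "x \<bullet> - x = -1"
          using nx by (simp flip: power2_norm_eq_inner)
        ultimately have "a = r"
          using al(1) r by (auto simp: field_simps)
        then have "a\<^sup>2 * (m + 2) = m - 1"
          using r2 m by simp
        then show False
          using al(5) m by simp
      qed
      then have "x \<bullet> y \<in> {0, a / r, - (a / r)}"
        using ra xy by blast
      moreover have "lift h x \<bullet> f y = r * (x \<bullet> y)"
        using f_lift[of y h x] by (simp add: r_def inner_commute)
      ultimately show ?thesis
        using r by auto
    qed
    have 22: "f x \<bullet> f y \<in> {1, -1, 0, a, - a}" if xy: "x \<in> X2" "y \<in> X2" for x y
    proof (cases "x = y")
      case True
      then have "norm x = 1"
        using X2'(2) xy by auto
      then show ?thesis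
        using True by (simp add: norm_f flip: power2_norm_eq_inner)
    next
      case False
      then have "x \<bullet> y \<in> inner_products X2 X2"
        using xy unfolding inner_products_def by blast
      then show ?thesis
        using i22 by auto
    qed
    have 21: "f x \<bullet> lift h y \<in> {1, -1, 0, a, - a}" if "x \<in> X2" "y \<in> X1" for x y
      using 12[OF that(2,1)] by (simp only: inner_commute[of "f x" "lift h y"])
    from xy show ?thesis
      unfolding L1_def L2_def by (elim UnE imageE) (simp_all only: 11 12 21 22)
  qed
  have ipD: "inner_products D D \<subseteq> {-1, 0, a, - a}"
  proof
    fix t assume "t \<in> inner_products D D"
    then obtain x y where xy: "x \<in> D" "y \<in> D" "x \<noteq> y" "t = x \<bullet> y"
      unfolding inner_products_def by blast
    have sgn: "\<exists>x'\<in>L1 \<union> L2. x = x' \<or> x = - x'" if "x \<in> D" for x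
      using that unfolding D_def by auto
    obtain x' y' where "x' \<in> L1 \<union> L2" "x = x' \<or> x = - x'" "y' \<in> L1 \<union> L2" "y = y' \<or> y = - y'"
      using sgn[OF xy(1)] sgn[OF xy(2)] by blast
    then have "t \<in> {1, -1, 0, a, - a}"
      using inner_L[of x' y'] xy(4) by auto
    moreover have "t \<noteq> 1"
    proof
      assume "t = 1"
      then have i: "x \<bullet> - y = -1"
        using xy(4) by simp
      have n: "norm x = 1" "norm (- y) = 1"
        using xy(1,2) sph by auto
      have "- y = - x"
        by (rule unit_inner_eq_minus_1[OF n i])
      then show False
        using xy(3) by simp
    qed
    ultimately show "t \<in> {-1, 0, a, - a}"
      by auto
  qed
  define K where "K = (\<lambda>x. card {y \<in> D - {x, - x}. x \<bullet> y \<noteq> 0})"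
  have even_sum: "(\<Sum>y\<in>D. (x \<bullet> y) ^ k) = 2 + K x * a ^ k" if "x \<in> D" "even k" "k > 0" for x k
    using sum_even_power_inner[OF fin antip sph ipD that] by (simp add: K_def)
  have K: "K x * a\<^sup>2 * m = 2 * (N - m)" if "x \<in> D" for x
  proof -
    have "norm x = 1"
      using that sph by auto
    then show ?thesis
      using even_sum[OF that, of 2] moment_2[of x] m by (simp add: field_simps)
  qed
  have sum_4: "(\<Sum>y\<in>D. (x \<bullet> y) ^ 4) = 6 * N / (m * (m + 2))" if "x \<in> D" for x
  proof -
    have "(2 + K x * a ^ 4) * (m * (m + 2)) = 2 * (m * (m + 2)) + (K x * a\<^sup>2 * m) * a\<^sup>2 * (m + 2)"
      by (simp add: power4_eq_xxxx power2_eq_square algebra_simps)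
    also have "\<dots> = 2 * (m * (m + 2)) + 2 * (a\<^sup>2 * ((m + 2) * (N - m)))"
      unfolding K[OF that] by (simp add: algebra_simps)
    also have "\<dots> = 6 * N"
      unfolding al(3) by (simp add: algebra_simps)
    finally show ?thesis
      using even_sum[OF that, of 4] m by (simp add: eq_divide_eq)
  qed
  have moment_4: "(\<Sum>x\<in>D. (v \<bullet> x) ^ 4) = 3 * card D * norm v ^ 4 / (m * (m + 2))" for v
    unfolding m_def
  proof (rule quartic_form_isotropic[OF sph])
    have "(\<Sum>x\<in>D. \<Sum>y\<in>D. (x \<bullet> y) ^ 4) = (\<Sum>x\<in>D. 6 * N / (m * (m + 2)))"
      by (intro sum.cong refl sum_4)
    then show "(\<Sum>x\<in>D. \<Sum>y\<in>D. (x \<bullet> y) ^ 4)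
        = 3 * (real (card D))\<^sup>2 / (real CARD('d) * (real CARD('d) + 2))"
      unfolding m_def[symmetric] using card_D by (simp add: N_def power2_eq_square)
  qed
  have nonempty: "D \<noteq> {}"
    using card_D al(2) m by (auto simp: N_def)
  have design: "spherical_design 5 D"
    unfolding antipodal_spherical_design_5_iff[OF antip] m_def[symmetric]
    using fin sph nonempty moment_2 moment_4 card_D by (simp add: N_def)
  obtain x where x: "x \<in> D"
    using nonempty by blast
  have nx: "norm x = 1" "- x \<in> D" "x \<noteq> - x"
    using x sph minus_D unit_neq_minus[of x] by auto
  have "inner_products D D = {-1, 0, a, - a}"
  proof (intro equalityI ipD)
    have "K x * a\<^sup>2 * m > 0"
      unfolding K[OF x] using al(2) by simp
    then have "K x \<noteq> 0"
      by (intro notI) simp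
    then have "{y \<in> D - {x, - x}. x \<bullet> y \<noteq> 0} \<noteq> {}"
      unfolding K_def by (metis card.empty)
    then obtain y where y: "y \<in> D" "y \<noteq> x" "y \<noteq> - x" "x \<bullet> y \<noteq> 0"
      by blast
    then have t: "x \<bullet> y \<in> inner_products D D"
      using x unfolding inner_products_def by blast
    have "norm y = 1"
      using y(1) sph by auto
    then have t1: "x \<bullet> y \<noteq> -1"
      using unit_inner_eq_minus_1[of x y] nx(1) y(3) by blast
    then have ya: "x \<bullet> y = a \<or> x \<bullet> y = - a"
      using t ipD y by auto
    have "- (x \<bullet> y) \<in> inner_products D D"
      by (rule inner_products_antipodal(1)[OF antip sph t t1])
    with ya t have aa: "a \<in> inner_products D D" "- a \<in> inner_products D D"
      by auto
    have "0 \<in> inner_products D D"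
    proof (rule ccontr)
      assume z: "0 \<notin> inner_products D D"
      have "{y \<in> D - {x, - x}. x \<bullet> y \<noteq> 0} = D - {x, - x}"
        using z x unfolding inner_products_def by force
      then have "K x = 2 * n - 2"
        using nx x card_D unfolding K_def by (simp add: card_Diff_subset)
      moreover have "n \<ge> 1"
        using al(2) m by (simp add: N_def)
      ultimately have KK: "real (K x) = 2 * (N - 1)"
        by (simp add: N_def of_nat_diff)
      have E: "(N - 1) * a\<^sup>2 * m = N - m"
        using K[OF x] unfolding KK by (simp add: algebra_simps)
      have "(N - 1) * m * (a\<^sup>2 * ((m + 2) * (N - m))) = ((N - 1) * a\<^sup>2 * m) * ((m + 2) * (N - m))"
        by (simp only: mult_ac)
      also have "\<dots> = (N - m) * ((m + 2) * (N - m))"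
        unfolding E ..
      finally have "(N - 1) * m * (3 * N - m * (m + 2)) = (N - m) * ((m + 2) * (N - m))"
        unfolding al(3) .
      then have "N * (m - 1) * (2 * N - m * (m + 1)) = 0"
        by algebra
      then show False
        using al(2) m n unfolding m_def[symmetric] N_def[symmetric] by auto
    qed
    then show "{-1, 0, a, - a} \<subseteq> inner_products D D"
      using aa minus_1_in_inner_products[OF antip sph nonempty] by blast
  qed
  moreover have "a \<noteq> 1"
  proof
    assume "a = 1"
    then show False
      using al(5) m by simp
  qed
  ultimately have "distance_set 4 D"
    using al(1) by (simp add: distance_set_def card_insert_if)
  moreover have "minimal_type D"
    unfolding minimal_type_def
  proof (intro exI[of _ "(1 / h) *\<^sub>R e"] conjI ballI)
    show "(1 / h) *\<^sub>R e \<noteq> 0"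
      using hnz norm_e by auto
    fix x assume "x \<in> D"
    then have "e \<bullet> x \<in> {h, 0, - h}"
      using e_L unfolding D_def by auto
    then show "(1 / h) *\<^sub>R e \<bullet> x \<in> {0, 1, -1}"
      using hnz by auto
  qed
  ultimately show ?thesis
    using design antip card_D by blast
qed

end

theorem theorem4p1:
  fixes d n :: nat
  assumes "CARD('d::finite) = d" and "CARD('e::finite) = d - 1"
    and "d > 4" and "real n > real d * (real d + 1) / 2"
  shows
    "(\<exists>D :: (real ^ 'd) set.
        spherical_design 5 D \<and> antipodal D \<and> distance_set 4 D \<and> card D = 2 * n \<and> minimal_type D)
     \<longleftrightarrow>
     (\<exists>X1 X2 X3 :: (real ^ 'e) set.
        spherical_design 3 X1 \<and> spherical_design 3 X2 \<and> spherical_design 3 X3 \<and>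
        X1 = uminus ` X3 \<and> X1 \<inter> uminus ` X1 = {} \<and> X2 = uminus ` X2 \<and>
        real (card X1) = (real d + 2) * real n / (3 * real d) \<and>
        real (card X3) = (real d + 2) * real n / (3 * real d) \<and>
        real (card X2) = 4 * (real d - 1) * real n / (3 * real d) \<and>
        inner_products X1 X1 \<subseteq>
          {- (3 / (real d - 1)),
           ((real d + 2) * alpha n d - 3) / (real d - 1),
           (- ((real d + 2) * alpha n d) - 3) / (real d - 1)} \<and>
        inner_products X3 X3 \<subseteq>
          {- (3 / (real d - 1)),
           ((real d + 2) * alpha n d - 3) / (real d - 1),
           (- ((real d + 2) * alpha n d) - 3) / (real d - 1)} \<and>
        inner_products X2 X2 \<subseteq> {-1, 0, alpha n d, - alpha n d} \<and>
        inner_products X1 X2 \<subseteq>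
          {0, sqrt ((real d + 2) / (real d - 1)) * alpha n d,
           - (sqrt ((real d + 2) / (real d - 1)) * alpha n d)} \<and>
        inner_products X2 X3 \<subseteq>
          {0, sqrt ((real d + 2) / (real d - 1)) * alpha n d,
           - (sqrt ((real d + 2) / (real d - 1)) * alpha n d)} \<and>
        inner_products X1 X3 \<subseteq>
          {-1, 3 / (real d - 1),
           ((real d + 2) * alpha n d + 3) / (real d - 1),
           (- ((real d + 2) * alpha n d) + 3) / (real d - 1)})"
    (is "(\<exists>D. ?design D) \<longleftrightarrow> (\<exists>X1 X2 X3. ?slices X1 X2 X3)")
proof
  have cards: "CARD('e) = CARD('d) - 1" "CARD('d) > 4"
    and n: "real n > real CARD('d) * (real CARD('d) + 1) / 2"
    using assms by simp_all
  {
    assume "\<exists>D. ?design D"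
    then obtain D :: "(real ^ 'd) set" where D: "spherical_design 5 D" "antipodal D" "distance_set 4 D"
      "card D = 2 * n" "minimal_type D"
      by blast
    have D': "D \<subseteq> sphere 0 1" "D \<noteq> {}"
      using D(1) by (auto simp: spherical_design_def)
    obtain b where b: "b > 0" "inner_products D D = {-1, 0, b, - b}"
      using antipodal_4_distance_set[OF D(2) D' D(3)] by metis
    then have b': "inner_products D D \<subseteq> {-1, 0, b, - b}"
      by simp
    note ab = antipodal_design_inner_product[OF D(1,2,4) b(1) b' cards(2) n]
    have ip: "inner_products D D \<subseteq> {-1, 0, alpha n d, - alpha n d}"
      using b' ab(1) assms(1) by simp
    obtain a where a: "a \<noteq> 0" "\<forall>x\<in>D. a \<bullet> x \<in> {0, 1, -1}"
      using D(5) unfolding minimal_type_def by blast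
    have na: "(norm a)\<^sup>2 = (real CARD('d) + 2) / 3"
      by (rule minimal_type_vector_norm[OF D(1,2) a])
    define e h where "e = a /\<^sub>R norm a" and "h = 1 / norm a"
    have e: "norm e = 1" "e \<noteq> 0"
      using a by (simp_all add: e_def)
    obtain f :: "real ^ 'e \<Rightarrow> real ^ 'd"
      where f: "linear f" "\<And>x. norm (f x) = norm x" "range f = {x. e \<bullet> x = 0}"
      using hyperplane_isometry[OF cards(1) e(2)] by metis
    have eq: "equator e f"
      by (intro equator.intro) (use e f in auto)
    interpret sliced_design e f h D
    proof (intro sliced_design.intro sliced_design_axioms.intro eq)
      show "h\<^sup>2 = 3 / (real CARD('d) + 2)"
        unfolding h_def power_divide na by simp
      fix x assume "x \<in> D"
      then show "e \<bullet> x \<in> {0, h, - h}"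
        using a(2) by (auto simp: e_def h_def divide_inverse)
    qed (use D cards in auto)
    define X1 X2 X3 where "X1 = lift h -` D" and "X2 = lift 0 -` D" and "X3 = lift (- h) -` D"
    have X13: "X1 = uminus ` X3" "X3 = uminus ` X1" "X2 = uminus ` X2"
      using minus_slice[of h] minus_slice[of "- h"] minus_slice[of 0]
      by (simp_all add: X1_def X2_def X3_def)
    interpret lower: sliced_design e f "- h" D
      by (intro sliced_design.intro sliced_design_axioms.intro eq)
        (use h2 heights design antip cards in auto)
    have "?slices X1 X2 X3"
    proof (intro conjI)
      show "spherical_design 3 X1" "spherical_design 3 X2" "spherical_design 3 X3"
        unfolding X1_def X2_def X3_def
        by (rule upper_slice_design middle_slice_design lower.upper_slice_design)+
      show "X1 = uminus ` X3" "X2 = uminus ` X2"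
        by (rule X13)+
      show "real (card X1) = (real d + 2) * real n / (3 * real d)"
        "real (card X3) = (real d + 2) * real n / (3 * real d)"
        "real (card X2) = 4 * (real d - 1) * real n / (3 * real d)"
        unfolding X1_def X2_def X3_def card_upper_slice card_middle_slice lower.card_upper_slice
        using assms D(4) by simp_all
      show i11: "inner_products X1 X1 \<subseteq> {- (3 / (real d - 1)), ((real d + 2) * alpha n d - 3) / (real d - 1),
           (- ((real d + 2) * alpha n d) - 3) / (real d - 1)}"
        "inner_products X3 X3 \<subseteq> {- (3 / (real d - 1)), ((real d + 2) * alpha n d - 3) / (real d - 1),
           (- ((real d + 2) * alpha n d) - 3) / (real d - 1)}"
        using inner_products_outer_slice[OF ip, of h] inner_products_outer_slice[OF ip, of "- h"] assms(1)
        unfolding X1_def X3_def by simp_all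
      show "inner_products X2 X2 \<subseteq> {-1, 0, alpha n d, - alpha n d}"
        using inner_products_middle_slice[OF ip] unfolding X2_def .
      show "inner_products X1 X2 \<subseteq> {0, sqrt ((real d + 2) / (real d - 1)) * alpha n d,
           - (sqrt ((real d + 2) / (real d - 1)) * alpha n d)}"
        "inner_products X2 X3 \<subseteq> {0, sqrt ((real d + 2) / (real d - 1)) * alpha n d,
           - (sqrt ((real d + 2) / (real d - 1)) * alpha n d)}"
        using inner_products_adjacent_slices[OF ip, of h] inner_products_adjacent_slices[OF ip, of "- h"]
          assms(1) inner_products_commute[of X2 X3]
        unfolding X1_def X2_def X3_def by simp_all
      show "inner_products X1 X3 \<subseteq> {-1, 3 / (real d - 1), ((real d + 2) * alpha n d + 3) / (real d - 1),
           (- ((real d + 2) * alpha n d) + 3) / (real d - 1)}"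
        using inner_products_opposite_slices[OF ip] assms(1) unfolding X1_def X3_def by simp
      show "X1 \<inter> uminus ` X1 = {}"
      proof (rule ccontr)
        assume "X1 \<inter> uminus ` X1 \<noteq> {}"
        then obtain y where y: "y \<in> X1" "- y \<in> X1"
          by auto
        then have ny: "norm y = 1"
          using slice_finite(2)[OF h2_less] unfolding X1_def by auto
        have "y \<bullet> - y \<in> inner_products X1 X1"
          using y unit_neq_minus[OF ny] unfolding inner_products_def by blast
        moreover have "y \<bullet> - y = -1"
          using ny by (simp flip: power2_norm_eq_inner)
        ultimately have "- 1 \<in> {- (3 / (real d - 1)), ((real d + 2) * alpha n d - 3) / (real d - 1),
            (- ((real d + 2) * alpha n d) - 3) / (real d - 1)}"
          using i11(1) by auto
        moreover have "(real d + 2) * alpha n d > 0"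
          using alpha_bounds(1)[OF assms(3,4)] by simp
        ultimately have "(real d + 2) * alpha n d = real d - 4"
          using assms(3) by (auto simp: field_simps)
        then show False
          using ab(2) alpha_neq[OF assms(3,4)] assms(1) by auto
      qed
    qed
    then show "\<exists>X1 X2 X3. ?slices X1 X2 X3"
      by (intro exI)
  next
    assume "\<exists>X1 X2 X3. ?slices X1 X2 X3"
    then show "\<exists>D. ?design D"
    proof (elim exE)
      fix X1 X2 X3 assume X: "?slices X1 X2 X3"
      obtain e :: "real ^ 'd" where e: "norm e = 1"
        using vector_choose_size[of 1] by auto
      then have "e \<noteq> 0"
        by auto
      then obtain f :: "real ^ 'e \<Rightarrow> real ^ 'd"
        where f: "linear f" "\<And>x. norm (f x) = norm x" "range f = {x. e \<bullet> x = 0}"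
        using hyperplane_isometry[OF cards(1)] by metis
      interpret equator e f
        by (intro equator.intro) (use e f in auto)
      have h: "(sqrt (3 / (real CARD('d) + 2)))\<^sup>2 = 3 / (real CARD('d) + 2)"
        by simp
      from X show "\<exists>D. ?design D"
      proof (elim conjE, goal_cases)
        case 1
        show ?case
          by (rule antipodal_5_design_of_slices[OF cards n h, of X1 X2], unfold assms(1)) (fact 1)+
      qed
    qed
  }
qed

end
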